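(* Let $(X_0,X_1)$ be a Banach couple with continuous embedding $X_1\hookrightarrow X_0$ and let $0<T<\infty$. Assume $$u\in L^\infty(0,T;X_1),\qquad u'\in BMO_*(0,T;X_0),$$ where $u'$ is the $X_0$-valued distributional derivative. Then $u$ has an $X_0$-valued continuous representative (still denoted $u$) and, for every $0<\eta<1$, $$u\in C\bigl([0,T];(X_0,X_1)_{\eta,\infty}\bigr).$$ More precisely, for $s,t\in[0,T]$ with $0<|t-s|\le T$, $$\|u(t)-u(s)\|_{(X_0,X_1)_{\eta,\infty}}\le C_\eta\Bigl(|t-s|\log\frac{eT}{|t-s|}\Bigr)^{1-\eta}\|u'\|_{BMO_*(0,T;X_0)}^{1-\eta}\,\|u\|_{L^\infty(0,T;X_1)}^{\eta},$$ with a constant $C_\eta$ depending only on $\eta$. Consequently, $$u\in C^{0,\alpha}\bigl([0,T];(X_0,X_1)_{\eta,\infty}\bigr)$$ for every $0<\alpha<1-\eta$.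
   Context: For a Banach space $X$ and $g\in L^1(0,T;X)$ put $g_I:=\frac1{|I|}\int_I g(t)\,dt$ for intervals $I\subset(0,T)$, $$[g]_{BMO(0,T;X)}:=\sup_{I\subset(0,T)}\frac1{|I|}\int_I\|g(t)-g_I\|_X\,dt,\qquad \|g\|_{BMO_*(0,T;X)}:=\|g_{(0,T)}\|_X+[g]_{BMO(0,T;X)},$$ the supremum being over all intervals $I\subset(0,T)$; $BMO_*(0,T;X)$ is the space of $g$ with finite $\|g\|_{BMO_*(0,T;X)}$. A Banach couple is a pair of Banach spaces continuously embedded in a common Hausdorff topological vector space. For $x\in X_0+X_1$ and $r>0$, $$K(r,x;X_0,X_1):=\inf\{\|x_0\|_{X_0}+r\|x_1\|_{X_1}: x=x_0+x_1,\ x_0\in X_0,\ x_1\in X_1\}.$$ For $0<\eta<1$, $(X_0,X_1)_{\eta,\infty}$ is the set of $x\in X_0+X_1$ with $\|x\|_{(X_0,X_1)_{\eta,\infty}}:=\sup_{r>0}r^{-\eta}K(r,x;X_0,X_1)<\infty$. For $0<\alpha\le1$, $C^{0,\alpha}([0,T];X)$ is the space of $u\in C([0,T];X)$ with $\sup_{0\le s<t\le T}\|u(t)-u(s)\|_X/|t-s|^\alpha<\infty$. *)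

theory Defs
  imports "HOL-Analysis.Analysis" "HOL-Probability.Essential_Supremum"
begin

section \<open>Bochner integration in arbitrary Banach spaces\<close>

text \<open>The library's Bochner integral is restricted to second countable (separable) spaces.
  The following is the same construction without that restriction: Borel measurability of the
  integrand is replaced by strong measurability, and everything else, including
  \<^const>\<open>Bochner_Integration.simple_bochner_integrable\<close> and \<^const>\<open>Bochner_Integration.simple_bochner_integral\<close>, is unchanged.\<close>

definition strongly_measurable :: "'c measure \<Rightarrow> ('c \<Rightarrow> 'a::real_normed_vector) \<Rightarrow> bool" where
  "strongly_measurable M f \<longleftrightarrow>
     (\<exists>s. (\<forall>i::nat. simple_function M (s i)) \<and> (AE x in M. (\<lambda>i. s i x) \<longlonglongrightarrow> f x))"

definition has_vec_integral ::
    "'c measure \<Rightarrow> ('c \<Rightarrow> 'a::real_normed_vector) \<Rightarrow> 'a \<Rightarrow> bool" where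
  "has_vec_integral M f x \<longleftrightarrow>
     strongly_measurable M f \<and>
     (\<exists>s. (\<forall>i::nat. Bochner_Integration.simple_bochner_integrable M (s i)) \<and>
          (\<lambda>i. \<integral>\<^sup>+t. ennreal (norm (f t - s i t)) \<partial>M) \<longlonglongrightarrow> 0 \<and>
          (\<lambda>i. Bochner_Integration.simple_bochner_integral M (s i)) \<longlonglongrightarrow> x)"

definition vec_integrable :: "'c measure \<Rightarrow> ('c \<Rightarrow> 'a::real_normed_vector) \<Rightarrow> bool" where
  "vec_integrable M f \<longleftrightarrow> (\<exists>x. has_vec_integral M f x)"

definition vec_integral :: "'c measure \<Rightarrow> ('c \<Rightarrow> 'a::real_normed_vector) \<Rightarrow> 'a" where
  "vec_integral M f = (if vec_integrable M f then THE x. has_vec_integral M f x else 0)"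

section \<open>Function spaces on an interval\<close>

definition Linf_enorm :: "real \<Rightarrow> (real \<Rightarrow> 'a::real_normed_vector) \<Rightarrow> ennreal" where
  "Linf_enorm T u = esssup (lebesgue_on {0<..<T}) (\<lambda>t. ennreal (norm (u t)))"

definition Linf :: "real \<Rightarrow> (real \<Rightarrow> 'a::real_normed_vector) set" where
  "Linf T = {u. strongly_measurable (lebesgue_on {0<..<T}) u \<and> Linf_enorm T u < \<infinity>}"

definition Linf_norm :: "real \<Rightarrow> (real \<Rightarrow> 'a::real_normed_vector) \<Rightarrow> real" where
  "Linf_norm T u = enn2real (Linf_enorm T u)"

definition avg :: "real set \<Rightarrow> (real \<Rightarrow> 'a::real_normed_vector) \<Rightarrow> 'a" where
  "avg I g = (1 / measure lebesgue I) *\<^sub>R vec_integral (lebesgue_on I) g"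

definition mean_osc :: "real set \<Rightarrow> (real \<Rightarrow> 'a::real_normed_vector) \<Rightarrow> ennreal" where
  "mean_osc I g =
     (\<integral>\<^sup>+t. ennreal (norm (g t - avg I g)) \<partial>lebesgue_on I) / ennreal (measure lebesgue I)"

definition BMO_seminorm :: "real \<Rightarrow> (real \<Rightarrow> 'a::real_normed_vector) \<Rightarrow> ennreal" where
  "BMO_seminorm T g =
     (SUP I \<in> {I. is_interval I \<and> I \<subseteq> {0<..<T} \<and> 0 < measure lebesgue I}. mean_osc I g)"

definition BMO_star_enorm :: "real \<Rightarrow> (real \<Rightarrow> 'a::real_normed_vector) \<Rightarrow> ennreal" where
  "BMO_star_enorm T g = ennreal (norm (avg {0<..<T} g)) + BMO_seminorm T g"

definition BMO_star :: "real \<Rightarrow> (real \<Rightarrow> 'a::real_normed_vector) set" where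
  "BMO_star T = {g. vec_integrable (lebesgue_on {0<..<T}) g \<and> BMO_star_enorm T g < \<infinity>}"

definition BMO_star_norm :: "real \<Rightarrow> (real \<Rightarrow> 'a::real_normed_vector) \<Rightarrow> real" where
  "BMO_star_norm T g = enn2real (BMO_star_enorm T g)"

section \<open>Distributional derivative\<close>

definition test_function :: "real \<Rightarrow> (real \<Rightarrow> real) \<Rightarrow> bool" where
  "test_function T \<phi> \<longleftrightarrow>
     (\<forall>n x. (deriv ^^ n) \<phi> field_differentiable at x) \<and>
     (\<exists>K. compact K \<and> K \<subseteq> {0<..<T} \<and> (\<forall>x. x \<notin> K \<longrightarrow> \<phi> x = 0))"

definition loc_integrable :: "real \<Rightarrow> (real \<Rightarrow> 'a::real_normed_vector) \<Rightarrow> bool" where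
  "loc_integrable T f \<longleftrightarrow>
     (\<forall>K. compact K \<and> K \<subseteq> {0<..<T} \<longrightarrow> vec_integrable (lebesgue_on K) f)"

definition has_distr_deriv ::
    "real \<Rightarrow> (real \<Rightarrow> 'a::real_normed_vector) \<Rightarrow> (real \<Rightarrow> 'a) \<Rightarrow> bool" where
  "has_distr_deriv T u v \<longleftrightarrow>
     loc_integrable T u \<and> loc_integrable T v \<and>
     (\<forall>\<phi>. test_function T \<phi> \<longrightarrow>
        vec_integral (lebesgue_on {0<..<T}) (\<lambda>t. deriv \<phi> t *\<^sub>R u t) =
        - vec_integral (lebesgue_on {0<..<T}) (\<lambda>t. \<phi> t *\<^sub>R v t))"

section \<open>Banach couples and real interpolation\<close>

text \<open>The two Banach spaces are types, and their embeddings into the ambient Hausdorff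
  topological vector space are explicit maps. Since there is no type class of topological vector
  spaces, joint continuity of scalar multiplication is part of the predicate.\<close>

definition banach_couple ::
    "('a::banach \<Rightarrow> 'v::{real_vector, topological_ab_group_add, t2_space}) \<Rightarrow>
     ('b::banach \<Rightarrow> 'v) \<Rightarrow> bool" where
  "banach_couple i0 i1 \<longleftrightarrow>
     continuous_on UNIV (\<lambda>(c::real, x::'v). c *\<^sub>R x) \<and>
     linear i0 \<and> inj i0 \<and> continuous_on UNIV i0 \<and>
     linear i1 \<and> inj i1 \<and> continuous_on UNIV i1"

definition couple_sum ::
    "('a::real_normed_vector \<Rightarrow> 'v::real_vector) \<Rightarrow> ('b::real_normed_vector \<Rightarrow> 'v) \<Rightarrow> 'v set" where
  "couple_sum i0 i1 = {i0 x0 + i1 x1 | x0 x1. True}"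

definition K_functional ::
    "('a::real_normed_vector \<Rightarrow> 'v::real_vector) \<Rightarrow> ('b::real_normed_vector \<Rightarrow> 'v) \<Rightarrow>
     real \<Rightarrow> 'v \<Rightarrow> real" where
  "K_functional i0 i1 r x = Inf {norm x0 + r * norm x1 | x0 x1. x = i0 x0 + i1 x1}"

text \<open>The extended norm is meaningful on \<^const>\<open>couple_sum\<close> only: outside it the infimum in
  \<^const>\<open>K_functional\<close> ranges over the empty set.\<close>

definition interp_enorm ::
    "('a::real_normed_vector \<Rightarrow> 'v::real_vector) \<Rightarrow> ('b::real_normed_vector \<Rightarrow> 'v) \<Rightarrow>
     real \<Rightarrow> 'v \<Rightarrow> ennreal" where
  "interp_enorm i0 i1 \<eta> x = (SUP r\<in>{0<..}. ennreal (r powr (- \<eta>) * K_functional i0 i1 r x))"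

definition interp_space ::
    "('a::real_normed_vector \<Rightarrow> 'v::real_vector) \<Rightarrow> ('b::real_normed_vector \<Rightarrow> 'v) \<Rightarrow>
     real \<Rightarrow> 'v set" where
  "interp_space i0 i1 \<eta> = {x \<in> couple_sum i0 i1. interp_enorm i0 i1 \<eta> x < \<infinity>}"

text \<open>Spaces of functions on \<open>[0,T]\<close> with values in a normed space given by a subspace \<open>Y\<close> of
  the ambient space and an extended norm \<open>N\<close> that is finite on \<open>Y\<close>.\<close>

definition C_into :: "real \<Rightarrow> 'v::real_vector set \<Rightarrow> ('v \<Rightarrow> ennreal) \<Rightarrow> (real \<Rightarrow> 'v) set" where
  "C_into T Y N = {f. (\<forall>t\<in>{0..T}. f t \<in> Y) \<and>
     (\<forall>t\<in>{0..T}. ((\<lambda>s. N (f s - f t)) \<longlongrightarrow> 0) (at t within {0..T}))}"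

definition Holder_into ::
    "real \<Rightarrow> real \<Rightarrow> 'v::real_vector set \<Rightarrow> ('v \<Rightarrow> ennreal) \<Rightarrow> (real \<Rightarrow> 'v) set" where
  "Holder_into \<alpha> T Y N = {f \<in> C_into T Y N.
     (SUP (s, t)\<in>{(s, t). 0 \<le> s \<and> s < t \<and> t \<le> T}.
        N (f t - f s) / ennreal (\<bar>t - s\<bar> powr \<alpha>)) < \<infinity>}"

text \<open>The constant is a closed term without type parameters because a formula of HOL cannot
  quantify over types: under an existential quantifier inside the theorem it could depend on the
  Banach spaces. The value comes from \<open>K(r,x) \<le> min a (r b)\<close>, where
  \<open>a = 3 |t-s| log(eT/|t-s|) \<parallel>u'\<parallel>\<close> (at most \<open>log2(T/|t-s|) + 1\<close> halvings of \<open>(0,T)\<close>,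
  each costing twice the seminorm, and \<open>2/log 2 < 3\<close>) and \<open>b = 2 \<parallel>u\<parallel>\<close>.\<close>

definition C_eta :: "real \<Rightarrow> real" where
  "C_eta \<eta> = 3 powr (1 - \<eta>) * 2 powr \<eta>"

end

theory Submission
  imports Defs
begin

text \<open>The distributional equation together with a du Bois-Reymond argument shows that \<open>u\<close> agrees
  almost everywhere with \<open>w t = c + \<integral>\<^bsub>0\<^esub>\<^bsup>t\<^esup> u'\<close>. For an interval \<open>J = (s, t)\<close> this gives
  \<open>w t - w s = (t - s) u'\<^bsub>J\<^esub>\<close>, and enlarging \<open>J\<close> to \<open>(0, T)\<close> in about \<open>log 2 (T / (t - s))\<close>
  steps, each of which at most doubles the length and so changes the mean by at most twice the BMO
  seminorm, bounds the mean \<open>u'\<^bsub>J\<^esub>\<close> by a multiple of \<open>ln (e T / (t - s))\<close>. On the other hand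
  \<open>w t - w s\<close> is a limit in \<open>X\<^sub>0\<close> of differences of values of \<open>u\<close> in a ball of \<open>X\<^sub>1\<close>. The two bounds
  give \<open>K(r, w t - w s) \<le> min a (r b)\<close>, and \<open>min a (r b) \<le> a\<^bsup>1-\<eta>\<^esup> (r b)\<^bsup>\<eta>\<^esup>\<close>.\<close>

section \<open>Strong measurability and the Bochner integral\<close>

text \<open>X_0 may be nonseparable, and this shapes the measure theory: sums of Borel functions
  need not be Borel there, so measurability is carried by almost everywhere limits of simple
  functions and is turned into Borel measurability, by completeness of Lebesgue measure, only where
  norms have to be integrated. For the same reason a function is recognized as zero from its
  integrals over measurable sets. The representative \<open>w\<close> is never claimed to be
  X_1-valued: a limit in X_0 of points of a ball of X_1 may leave X_1 when X_1 is not reflexive.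
  Hence the bound \<open>r b\<close> for the K-functional is obtained by approximation, and
  membership of \<open>w t\<close> in the interpolation space is itself a consequence of the
  estimate. The mean over \<open>(0, T)\<close> is part of the norm of u' because the chain of
  enlarged intervals ends there and the seminorm does not see constants. The \<open>e\<close> in the
  logarithm keeps it at least 1, also for \<open>t - s = T\<close>.\<close>

lemma strongly_measurable_simple:
  "simple_function M f \<Longrightarrow> strongly_measurable M f"
  unfolding strongly_measurable_def by (rule exI[where x="\<lambda>_. f"]) auto

text \<open>Simple functions stay simple under any map of their values, so joint sequential
  continuity of \<open>p\<close> is enough to carry the approximants to the limit. The algebraic
  closure properties are instances.\<close>

lemma strongly_measurable_compose2:
  fixes p :: "'b::real_normed_vector \<Rightarrow> 'c::real_normed_vector \<Rightarrow> 'd::real_normed_vector"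
  assumes f: "strongly_measurable M f" and g: "strongly_measurable M g"
    and p: "\<And>a b x y. a \<longlonglongrightarrow> x \<Longrightarrow> b \<longlonglongrightarrow> y \<Longrightarrow> (\<lambda>n. p (a n) (b n)) \<longlonglongrightarrow> p x y"
  shows "strongly_measurable M (\<lambda>t. p (f t) (g t))"
proof -
  obtain a b where a: "\<And>i::nat. simple_function M (a i)" "AE x in M. (\<lambda>i. a i x) \<longlonglongrightarrow> f x"
    and b: "\<And>i::nat. simple_function M (b i)" "AE x in M. (\<lambda>i. b i x) \<longlonglongrightarrow> g x"
    using f g unfolding strongly_measurable_def by blast
  have "AE x in M. (\<lambda>i. p (a i x) (b i x)) \<longlonglongrightarrow> p (f x) (g x)"
    using a(2) b(2) by eventually_elim (rule p)
  then show ?thesis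
    unfolding strongly_measurable_def
    by (intro exI[where x="\<lambda>i x. p (a i x) (b i x)"]) (auto intro: simple_function_compose2 a b)
qed

lemma strongly_measurable_const: "strongly_measurable M (\<lambda>_. c)"
  by (rule strongly_measurable_simple) simp

lemma strongly_measurable_add:
  "strongly_measurable M f \<Longrightarrow> strongly_measurable M g \<Longrightarrow> strongly_measurable M (\<lambda>t. f t + g t)"
  by (rule strongly_measurable_compose2) (auto intro: tendsto_add)

lemma strongly_measurable_diff:
  "strongly_measurable M f \<Longrightarrow> strongly_measurable M g \<Longrightarrow> strongly_measurable M (\<lambda>t. f t - g t)"
  by (rule strongly_measurable_compose2) (auto intro: tendsto_diff)

lemma strongly_measurable_real:
  fixes f :: "'c \<Rightarrow> real"
  assumes "f \<in> borel_measurable M" shows "strongly_measurable M f"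
proof -
  obtain F where "\<And>i. simple_function M (F i)" "\<And>x. x \<in> space M \<Longrightarrow> (\<lambda>i. F i x) \<longlonglongrightarrow> f x"
    using borel_measurable_implies_sequence_metric[OF assms] by blast
  then show ?thesis
    unfolding strongly_measurable_def by (intro exI[where x=F]) auto
qed

lemma strongly_measurable_scaleR:
  fixes r :: "'c \<Rightarrow> real"
  shows "r \<in> borel_measurable M \<Longrightarrow> strongly_measurable M g \<Longrightarrow> strongly_measurable M (\<lambda>t. r t *\<^sub>R g t)"
  by (rule strongly_measurable_compose2) (auto intro: tendsto_scaleR strongly_measurable_real)

lemma strongly_measurable_bounded_linear:
  assumes "bounded_linear L" "strongly_measurable M f"
  shows "strongly_measurable M (\<lambda>t. L (f t))"
  by (rule strongly_measurable_compose2[where p="\<lambda>x y. L x", OF assms(2) strongly_measurable_const[of M "0::real"]])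
     (rule bounded_linear.tendsto[OF assms(1)])

lemma strongly_measurable_cong_AE:
  assumes "AE x in M. f x = g x" "strongly_measurable M f"
  shows "strongly_measurable M g"
proof -
  obtain a where a: "\<And>i::nat. simple_function M (a i)" "AE x in M. (\<lambda>i. a i x) \<longlonglongrightarrow> f x"
    using assms(2) unfolding strongly_measurable_def by blast
  have "AE x in M. (\<lambda>i. a i x) \<longlonglongrightarrow> g x"
    using a(2) assms(1) by eventually_elim simp
  with a(1) show ?thesis unfolding strongly_measurable_def by blast
qed

lemma strongly_measurable_restrict_space:
  assumes S: "S \<inter> space M \<in> sets M"
  shows "strongly_measurable (restrict_space M S) f \<longleftrightarrow> strongly_measurable M (\<lambda>x. indicator S x *\<^sub>R f x)"
proof
  assume "strongly_measurable (restrict_space M S) f"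
  then obtain a where a: "\<And>i::nat. simple_function (restrict_space M S) (a i)"
     "AE x in restrict_space M S. (\<lambda>i. a i x) \<longlonglongrightarrow> f x"
    unfolding strongly_measurable_def by blast
  have "AE x in M. (\<lambda>i. indicator S x *\<^sub>R a i x) \<longlonglongrightarrow> indicator S x *\<^sub>R f x"
    using a(2) unfolding AE_restrict_space_iff[OF S]
    by eventually_elim (auto split: split_indicator)
  with a(1) show "strongly_measurable M (\<lambda>x. indicator S x *\<^sub>R f x)"
    unfolding strongly_measurable_def simple_function_restrict_space[OF S]
    by (intro exI[where x="\<lambda>i x. indicator S x *\<^sub>R a i x"] conjI allI)
next
  assume "strongly_measurable M (\<lambda>x. indicator S x *\<^sub>R f x)"
  then obtain a where a: "\<And>i::nat. simple_function M (a i)"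
     "AE x in M. (\<lambda>i. a i x) \<longlonglongrightarrow> indicator S x *\<^sub>R f x"
    unfolding strongly_measurable_def by blast
  have "simple_function M (\<lambda>x. indicator S x *\<^sub>R a i x)" for i
  proof -
    have "{x \<in> space M. x \<in> S} = S \<inter> space M" by auto
    then have "simple_function M (\<lambda>x. if x \<in> S then a i x else 0)"
      using S by (intro simple_function_If a simple_function_const) simp
    moreover have "(\<lambda>x. if x \<in> S then a i x else 0) = (\<lambda>x. indicator S x *\<^sub>R a i x)"
      by (auto split: split_indicator)
    ultimately show ?thesis by simp
  qed
  moreover have "AE x in restrict_space M S. (\<lambda>i. a i x) \<longlonglongrightarrow> f x"
    unfolding AE_restrict_space_iff[OF S] using a(2) by eventually_elim auto
  ultimately show "strongly_measurable (restrict_space M S) f"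
    unfolding strongly_measurable_def simple_function_restrict_space[OF S]
    by (intro exI[where x=a] conjI allI)
qed

text \<open>Set to 0 on the exceptional null set, the function is a pointwise limit of Borel
  functions; preimages under the original differ only inside a null set, which completeness makes
  measurable. In a nonseparable space Borel functions are not closed under addition, so below a
  difference is always shown strongly measurable before this lemma is applied to it.\<close>

lemma (in complete_measure) strongly_measurable_imp_borel:
  assumes "strongly_measurable M f" shows "f \<in> borel_measurable M"
proof -
  obtain a where a: "\<And>i::nat. simple_function M (a i)" "AE x in M. (\<lambda>i. a i x) \<longlonglongrightarrow> f x"
    using assms unfolding strongly_measurable_def by blast
  from AE_E3[OF a(2)] obtain N where N: "N \<in> null_sets M"
    and lim: "\<And>x. x \<in> space M - N \<Longrightarrow> (\<lambda>i. a i x) \<longlonglongrightarrow> f x"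
    by blast
  define f' where "f' x = (if x \<in> N then 0 else f x)" for x
  have "f' \<in> borel_measurable M"
  proof (rule borel_measurable_LIMSEQ_metric)
    show "(\<lambda>x. if x \<in> N then 0 else a i x) \<in> borel_measurable M" for i
      using N by (intro measurable_If_set borel_measurable_simple_function a) auto
    show "(\<lambda>i. if x \<in> N then 0 else a i x) \<longlonglongrightarrow> f' x" if "x \<in> space M" for x
      using lim[of x] that by (simp add: f'_def)
  qed
  have AE: "AE x in M. f' x = f x"
    using AE_not_in[OF N] by eventually_elim (simp add: f'_def)
  show ?thesis
  proof (rule measurableI)
    fix A :: "'b set" assume "A \<in> sets borel"
    then have "f' -` A \<inter> space M \<in> sets M"
      using \<open>f' \<in> borel_measurable M\<close> by (rule measurable_sets[rotated])
    moreover have "AE x in M. x \<in> f' -` A \<inter> space M \<longleftrightarrow> x \<in> f -` A \<inter> space M"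
      using AE by eventually_elim simp
    ultimately show "f -` A \<inter> space M \<in> sets M"
      using in_sets_AE by blast
  qed simp
qed

section \<open>Uniqueness and existence of the vector integral\<close>

lemma simple_bochner_integrable_strongly_measurable:
  "Bochner_Integration.simple_bochner_integrable M f \<Longrightarrow> strongly_measurable M f"
  by (auto intro: strongly_measurable_simple elim: simple_bochner_integrable.cases)

text \<open>One triangle inequality behind the whole integral. For \<open>f = g\<close> it makes the
  integrals of approximating simple functions Cauchy and their limit independent of the choice; in
  the limit it bounds the distance of two integrals by the mean distance of the integrands.\<close>

lemma (in complete_measure) simple_integral_diff_bound:
  assumes f: "strongly_measurable M f" and g: "strongly_measurable M g"
  assumes s: "Bochner_Integration.simple_bochner_integrable M s"
    and t: "Bochner_Integration.simple_bochner_integrable M t"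
  shows "ennreal (norm (Bochner_Integration.simple_bochner_integral M s - Bochner_Integration.simple_bochner_integral M t)) \<le>
    (\<integral>\<^sup>+ x. norm (f x - s x) \<partial>M) + (\<integral>\<^sup>+ x. norm (g x - t x) \<partial>M) + (\<integral>\<^sup>+ x. norm (f x - g x) \<partial>M)"
    (is "ennreal (norm (?s - ?t)) \<le> ?S + ?T + ?U")
proof -
  note sm = simple_bochner_integrable_strongly_measurable
  have [measurable]: "(\<lambda>x. f x - s x) \<in> borel_measurable M" "(\<lambda>x. g x - t x) \<in> borel_measurable M"
     "(\<lambda>x. f x - g x) \<in> borel_measurable M"
    by (intro strongly_measurable_imp_borel strongly_measurable_diff f g sm[OF s] sm[OF t])+
  have "ennreal (norm (?s - ?t)) = norm (Bochner_Integration.simple_bochner_integral M (\<lambda>x. s x - t x))"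
    using s t by (subst simple_bochner_integral_diff) auto
  also have "\<dots> \<le> Bochner_Integration.simple_bochner_integral M (\<lambda>x. norm (s x - t x))"
    using simple_bochner_integrable_compose2[of "(-)" M "s" "t"] s t
    by (auto intro!: simple_bochner_integral_norm_bound)
  also have "\<dots> = (\<integral>\<^sup>+x. norm (s x - t x) \<partial>M)"
    using simple_bochner_integrable_compose2[of "\<lambda>x y. norm (x - y)" M "s" "t"] s t
    by (auto intro!: simple_bochner_integral_eq_nn_integral)
  also have "\<dots> \<le> (\<integral>\<^sup>+x. ennreal (norm (f x - s x)) + ennreal (norm (g x - t x)) + ennreal (norm (f x - g x)) \<partial>M)"
  proof (rule nn_integral_mono)
    fix x
    have "s x - t x = (g x - t x) - (f x - s x) + (f x - g x)" by simp
    then have "norm (s x - t x) \<le> norm (f x - s x) + norm (g x - t x) + norm (f x - g x)"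
      by (smt (verit) norm_triangle_ineq norm_triangle_ineq4)
    then show "ennreal (norm (s x - t x)) \<le> ennreal (norm (f x - s x)) + ennreal (norm (g x - t x)) + ennreal (norm (f x - g x))"
      by (simp flip: ennreal_plus)
  qed
  also have "\<dots> = ?S + ?T + ?U"
    by (simp add: nn_integral_add)
  finally show ?thesis .
qed

lemma (in complete_measure) has_vec_integral_diff_bound:
  assumes f: "has_vec_integral M f x" and g: "has_vec_integral M g y"
  shows "ennreal (norm (x - y)) \<le> (\<integral>\<^sup>+ t. norm (f t - g t) \<partial>M)"
proof -
  obtain s where s: "\<And>i::nat. Bochner_Integration.simple_bochner_integrable M (s i)"
     "(\<lambda>i. \<integral>\<^sup>+t. ennreal (norm (f t - s i t)) \<partial>M) \<longlonglongrightarrow> 0"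
     "(\<lambda>i. Bochner_Integration.simple_bochner_integral M (s i)) \<longlonglongrightarrow> x"
    and fm: "strongly_measurable M f"
    using f unfolding has_vec_integral_def by blast
  obtain s' where s': "\<And>i::nat. Bochner_Integration.simple_bochner_integrable M (s' i)"
     "(\<lambda>i. \<integral>\<^sup>+t. ennreal (norm (g t - s' i t)) \<partial>M) \<longlonglongrightarrow> 0"
     "(\<lambda>i. Bochner_Integration.simple_bochner_integral M (s' i)) \<longlonglongrightarrow> y"
    and gm: "strongly_measurable M g"
    using g unfolding has_vec_integral_def by blast
  have "(\<lambda>i. ennreal (norm (Bochner_Integration.simple_bochner_integral M (s i) - Bochner_Integration.simple_bochner_integral M (s' i)))) \<longlonglongrightarrow> ennreal (norm (x - y))"
    by (intro tendsto_intros s s')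
  moreover have "(\<lambda>i. (\<integral>\<^sup>+ t. norm (f t - s i t) \<partial>M) + (\<integral>\<^sup>+ t. norm (g t - s' i t) \<partial>M) + (\<integral>\<^sup>+ x. norm (f x - g x) \<partial>M))
     \<longlonglongrightarrow> 0 + 0 + (\<integral>\<^sup>+ x. norm (f x - g x) \<partial>M)"
    by (intro tendsto_add s s' tendsto_const)
  ultimately show ?thesis
    using simple_integral_diff_bound[OF fm gm s(1) s'(1)]
    by (auto intro: LIMSEQ_le)
qed

lemma (in complete_measure) has_vec_integral_unique:
  assumes "has_vec_integral M f x" "has_vec_integral M f y"
  shows "x = y"
  using has_vec_integral_diff_bound[OF assms] by simp

lemma (in complete_measure) vec_integral_eq:
  assumes "has_vec_integral M f x" shows "vec_integral M f = x"
  unfolding vec_integral_def vec_integrable_def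
  using assms has_vec_integral_unique by (auto intro: the_equality)

lemma (in complete_measure) has_vec_integralI_bounded:
  fixes f :: "'a \<Rightarrow> 'b::banach"
  assumes f: "strongly_measurable M f" and fin: "(\<integral>\<^sup>+ x. norm (f x) \<partial>M) < \<infinity>"
  shows "\<exists>x. has_vec_integral M f x"
proof -
  obtain a where a: "\<And>i::nat. simple_function M (a i)" "AE x in M. (\<lambda>i. a i x) \<longlonglongrightarrow> f x"
    using f unfolding strongly_measurable_def by blast
  \<comment> \<open>The approximants converge only pointwise; cutting them off at
    \<open>2 * norm (f x)\<close> provides the integrable majorant \<open>3 * norm (f x)\<close> for
    the differences below. The factor 2 leaves room: where \<open>f x\<close> is nonzero,
    \<open>norm (a i x)\<close> eventually lies below the threshold, and where
    \<open>f x = 0\<close> the cut-off value is 0.\<close>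
  define s where "s i x = (if norm (a i x) \<le> 2 * norm (f x) then a i x else 0)" for i x
  have [measurable]: "f \<in> borel_measurable M" "a i \<in> borel_measurable M" for i
    using strongly_measurable_imp_borel[OF f] borel_measurable_simple_function[OF a(1)] by auto
  have s_simple: "simple_function M (s i)" for i
    unfolding s_def by (intro simple_function_If a simple_function_const) measurable
  have s_le: "norm (s i x) \<le> 2 * norm (f x)" for i x
    by (simp add: s_def)
  have "(\<integral>\<^sup>+ x. norm (s i x) \<partial>M) < \<infinity>" for i
  proof -
    have "(\<integral>\<^sup>+ x. norm (s i x) \<partial>M) \<le> (\<integral>\<^sup>+ x. ennreal 2 * ennreal (norm (f x)) \<partial>M)"
      by (intro nn_integral_mono) (simp flip: ennreal_mult del: ennreal_numeral, intro ennreal_leI s_le)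
    also have "\<dots> < \<infinity>"
      using fin by (subst nn_integral_cmult) (auto simp: ennreal_mult_less_top)
    finally show ?thesis .
  qed
  then have sb: "Bochner_Integration.simple_bochner_integrable M (s i)" for i
    by (intro simple_bochner_integrableI_bounded s_simple)
  have lim: "AE x in M. (\<lambda>i. s i x) \<longlonglongrightarrow> f x"
    using a(2)
  proof eventually_elim
    fix x assume x: "(\<lambda>i. a i x) \<longlonglongrightarrow> f x"
    show "(\<lambda>i. s i x) \<longlonglongrightarrow> f x"
    proof (cases "f x = 0")
      case True
      then have "s i x = 0" for i using s_le[of i x] by simp
      then show ?thesis by (simp add: True)
    next
      case False
      have "(\<lambda>i. norm (a i x)) \<longlonglongrightarrow> norm (f x)" by (intro tendsto_norm x)
      then have "\<forall>\<^sub>F i in sequentially. norm (a i x) < 2 * norm (f x)"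
        by (rule order_tendstoD) (use False in simp)
      then have "\<forall>\<^sub>F i in sequentially. s i x = a i x"
        by eventually_elim (simp add: s_def)
      with x show ?thesis by (simp add: tendsto_cong)
    qed
  qed
  have [measurable]: "(\<lambda>x. f x - s i x) \<in> borel_measurable M" for i
    by (intro strongly_measurable_imp_borel strongly_measurable_diff f strongly_measurable_simple s_simple)
  have conv: "(\<lambda>i. \<integral>\<^sup>+t. ennreal (norm (f t - s i t)) \<partial>M) \<longlonglongrightarrow> (\<integral>\<^sup>+t. 0 \<partial>M)"
  proof (rule nn_integral_dominated_convergence[where w="\<lambda>x. ennreal 3 * ennreal (norm (f x))"])
    show "AE x in M. ennreal (norm (f x - s j x)) \<le> ennreal 3 * ennreal (norm (f x))" for j
    proof (rule AE_I2)
      fix x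
      have "norm (f x - s j x) \<le> 3 * norm (f x)"
        using s_le[of j x] norm_triangle_ineq4[of "f x" "s j x"] by simp
      then show "ennreal (norm (f x - s j x)) \<le> ennreal 3 * ennreal (norm (f x))"
        by (simp flip: ennreal_mult del: ennreal_numeral add: ennreal_leI)
    qed
    show "(\<integral>\<^sup>+ x. ennreal 3 * ennreal (norm (f x)) \<partial>M) < \<infinity>"
      using fin by (subst nn_integral_cmult) (auto simp: ennreal_mult_less_top)
    show "AE x in M. (\<lambda>i. ennreal (norm (f x - s i x))) \<longlonglongrightarrow> 0"
      using lim
    proof eventually_elim
      fix x assume "(\<lambda>i. s i x) \<longlonglongrightarrow> f x"
      then have "(\<lambda>i. ennreal (norm (f x - s i x))) \<longlonglongrightarrow> ennreal (norm (f x - f x))"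
        by (intro tendsto_intros)
      then show "(\<lambda>i. ennreal (norm (f x - s i x))) \<longlonglongrightarrow> 0" by simp
    qed
  qed auto
  have "Cauchy (\<lambda>i. Bochner_Integration.simple_bochner_integral M (s i))"
  proof (rule metric_CauchyI)
    fix e :: real assume "0 < e"
    then have "\<forall>\<^sub>F i in sequentially. (\<integral>\<^sup>+t. ennreal (norm (f t - s i t)) \<partial>M) < ennreal (e / 2)"
      using conv by (intro order_tendstoD(2)[OF conv]) auto
    then obtain N where N: "\<And>i. N \<le> i \<Longrightarrow> (\<integral>\<^sup>+t. ennreal (norm (f t - s i t)) \<partial>M) < ennreal (e / 2)"
      unfolding eventually_sequentially by blast
    have "dist (Bochner_Integration.simple_bochner_integral M (s i)) (Bochner_Integration.simple_bochner_integral M (s j)) < e"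
      if ij: "N \<le> i" "N \<le> j" for i j
    proof -
      have "ennreal (norm (Bochner_Integration.simple_bochner_integral M (s i) - Bochner_Integration.simple_bochner_integral M (s j)))
         \<le> (\<integral>\<^sup>+t. ennreal (norm (f t - s i t)) \<partial>M) + (\<integral>\<^sup>+t. ennreal (norm (f t - s j t)) \<partial>M)"
        using simple_integral_diff_bound[OF f f sb sb, of i j] by simp
      also have "\<dots> < ennreal (e/2) + ennreal (e/2)"
        using N ij by (intro add_strict_mono) auto
      also have "\<dots> = ennreal e" using \<open>0 < e\<close> by (simp flip: ennreal_plus)
      finally show ?thesis using \<open>0 < e\<close> by (simp add: dist_norm ennreal_less_iff)
    qed
    then show "\<exists>N. \<forall>m\<ge>N. \<forall>n\<ge>N. dist (Bochner_Integration.simple_bochner_integral M (s m)) (Bochner_Integration.simple_bochner_integral M (s n)) < e"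
      by blast
  qed
  then obtain x where "(\<lambda>i. Bochner_Integration.simple_bochner_integral M (s i)) \<longlonglongrightarrow> x"
    using Cauchy_convergent convergent_def by blast
  then show ?thesis
    unfolding has_vec_integral_def using f sb conv by auto
qed

lemma has_vec_integral_real:
  fixes f :: "'c \<Rightarrow> real"
  assumes "has_bochner_integral M f x" shows "has_vec_integral M f x"
  using assms unfolding has_vec_integral_def has_bochner_integral.simps
  by (auto intro: strongly_measurable_real)

text \<open>One approximating simple function at mean distance less than 1 suffices, since its own
  norm has finite integral.\<close>

lemma has_vec_integral_finite:
  assumes "has_vec_integral M f x" and "complete_measure M"
  shows "(\<integral>\<^sup>+ x. norm (f x) \<partial>M) < \<infinity>"
proof -
  interpret complete_measure M by fact
  obtain s where s: "\<And>i::nat. Bochner_Integration.simple_bochner_integrable M (s i)"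
     "(\<lambda>i. \<integral>\<^sup>+t. ennreal (norm (f t - s i t)) \<partial>M) \<longlonglongrightarrow> 0"
    and fm: "strongly_measurable M f"
    using assms(1) unfolding has_vec_integral_def by blast
  have "\<forall>\<^sub>F i in sequentially. (\<integral>\<^sup>+t. ennreal (norm (f t - s i t)) \<partial>M) < 1"
    by (rule order_tendstoD(2)[OF s(2)]) simp
  then obtain i where i: "(\<integral>\<^sup>+t. ennreal (norm (f t - s i t)) \<partial>M) < 1"
    by (auto dest: eventually_happens)
  note sm = simple_bochner_integrable_strongly_measurable[OF s(1)]
  have [measurable]: "(\<lambda>x. f x - s i x) \<in> borel_measurable M" "s i \<in> borel_measurable M"
    by (auto intro!: strongly_measurable_imp_borel strongly_measurable_diff fm sm)
  have "Bochner_Integration.simple_bochner_integrable M (\<lambda>x. norm (s i x))"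
    using simple_bochner_integrable_compose2[of "\<lambda>x y. norm x", OF _ s(1) s(1)] by simp
  then have si: "(\<integral>\<^sup>+ x. norm (s i x) \<partial>M) < \<infinity>"
    by (subst simple_bochner_integral_eq_nn_integral[symmetric]) auto
  have "(\<integral>\<^sup>+ x. norm (f x) \<partial>M) \<le> (\<integral>\<^sup>+ x. ennreal (norm (f x - s i x)) + ennreal (norm (s i x)) \<partial>M)"
  proof (rule nn_integral_mono)
    show "ennreal (norm (f x)) \<le> ennreal (norm (f x - s i x)) + ennreal (norm (s i x))" for x
      using norm_triangle_ineq[of "f x - s i x" "s i x"] by (simp flip: ennreal_plus)
  qed
  also have "\<dots> = (\<integral>\<^sup>+ x. norm (f x - s i x) \<partial>M) + (\<integral>\<^sup>+ x. norm (s i x) \<partial>M)"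
    by (rule nn_integral_add) auto
  also have "\<dots> < \<infinity>" using i si by (auto simp: less_top intro: less_trans)
  finally show ?thesis .
qed

section \<open>Restriction, linearity and convergence of the vector integral\<close>

context complete_measure
begin

text \<open>Moves integrals over intervals to the whole line, so that later arguments deal with a
  single measure and with indicator functions.\<close>

lemma has_vec_integral_restrict_space:
  assumes S: "S \<inter> space M \<in> sets M"
  shows "has_vec_integral (restrict_space M S) f x \<longleftrightarrow> has_vec_integral M (\<lambda>t. indicator S t *\<^sub>R f t) x"
proof
  assume "has_vec_integral (restrict_space M S) f x"
  then obtain s where s: "\<And>i::nat. Bochner_Integration.simple_bochner_integrable (restrict_space M S) (s i)"
     "(\<lambda>i. \<integral>\<^sup>+t. ennreal (norm (f t - s i t)) \<partial>restrict_space M S) \<longlonglongrightarrow> 0"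
     "(\<lambda>i. Bochner_Integration.simple_bochner_integral (restrict_space M S) (s i)) \<longlonglongrightarrow> x"
    and f: "strongly_measurable (restrict_space M S) f"
    unfolding has_vec_integral_def by blast
  have eq: "(\<lambda>t. ennreal (norm (f t - s i t)) * indicator S t) =
     (\<lambda>t. ennreal (norm (indicator S t *\<^sub>R f t - indicator S t *\<^sub>R s i t)))" for i
    by (auto split: split_indicator)
  show "has_vec_integral M (\<lambda>t. indicator S t *\<^sub>R f t) x"
    unfolding has_vec_integral_def
    using f s unfolding strongly_measurable_restrict_space[OF S] nn_integral_restrict_space[OF S] eq
      simple_bochner_integral_restrict_space[OF S s(1)] simple_bochner_integrable_restrict_space[OF S]
    by (intro conjI exI[where x="\<lambda>i t. indicator S t *\<^sub>R s i t"] allI)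
next
  assume "has_vec_integral M (\<lambda>t. indicator S t *\<^sub>R f t) x"
  then obtain s where s: "\<And>i::nat. Bochner_Integration.simple_bochner_integrable M (s i)"
     "(\<lambda>i. \<integral>\<^sup>+t. ennreal (norm (indicator S t *\<^sub>R f t - s i t)) \<partial>M) \<longlonglongrightarrow> 0"
     "(\<lambda>i. Bochner_Integration.simple_bochner_integral M (s i)) \<longlonglongrightarrow> x"
    and f: "strongly_measurable M (\<lambda>t. indicator S t *\<^sub>R f t)"
    unfolding has_vec_integral_def by blast
  let ?s = "\<lambda>i t. indicator S t *\<^sub>R s i t"
  have s_simple: "simple_function M (s i)" for i
    using s(1)[of i] by (auto elim: simple_bochner_integrable.cases)
  have rsimple: "simple_function (restrict_space M S) (s i)" for i
    unfolding simple_function_def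
  proof
    show "finite (s i ` space (restrict_space M S))"
      using s_simple[of i] unfolding simple_function_def
      by (auto simp: space_restrict_space intro: finite_subset[rotated])
    show "\<forall>x\<in>s i ` space (restrict_space M S). s i -` {x} \<inter> space (restrict_space M S) \<in> sets (restrict_space M S)"
    proof
      fix x
      have "s i -` {x} \<inter> space M \<in> sets M"
        using s_simple[of i] by (metis simple_functionD(2))
      moreover have "s i -` {x} \<inter> space (restrict_space M S) = S \<inter> (s i -` {x} \<inter> space M)"
        by (auto simp: space_restrict_space)
      ultimately show "s i -` {x} \<inter> space (restrict_space M S) \<in> sets (restrict_space M S)"
        unfolding sets_restrict_space by blast
    qed
  qed
  have fin: "emeasure (restrict_space M S) {y \<in> space (restrict_space M S). s i y \<noteq> 0} \<noteq> \<infinity>" for i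
  proof -
    have "s i -` (UNIV - {0}) \<inter> space M \<in> sets M"
      using s_simple[of i] by (rule simple_functionD(2))
    moreover have "s i -` (UNIV - {0}) \<inter> space M = {y \<in> space M. s i y \<noteq> 0}" by auto
    ultimately have "{y \<in> space M. s i y \<noteq> 0} \<in> sets M" by simp
    then have "emeasure M {y \<in> space (restrict_space M S). s i y \<noteq> 0} \<le> emeasure M {y \<in> space M. s i y \<noteq> 0}"
      by (intro emeasure_mono) (auto simp: space_restrict_space)
    moreover have "\<dots> < \<infinity>"
      using s(1)[of i] by (auto elim!: simple_bochner_integrable.cases simp: less_top)
    ultimately have "emeasure M {y \<in> space (restrict_space M S). s i y \<noteq> 0} < \<infinity>"
      by (rule le_less_trans)
    then show ?thesis
      using emeasure_restrict_space[OF S, of "{y \<in> space (restrict_space M S). s i y \<noteq> 0}"]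
      by (auto simp: space_restrict_space less_top)
  qed
  have rs: "Bochner_Integration.simple_bochner_integrable (restrict_space M S) (s i)" for i
    using rsimple fin by (rule simple_bochner_integrable.intros)
  have rs': "Bochner_Integration.simple_bochner_integrable M (?s i)" for i
    using rs unfolding simple_bochner_integrable_restrict_space[OF S] .
  have le: "(\<integral>\<^sup>+t. ennreal (norm (indicator S t *\<^sub>R f t - ?s i t)) \<partial>M)
      \<le> (\<integral>\<^sup>+t. ennreal (norm (indicator S t *\<^sub>R f t - s i t)) \<partial>M)" for i
    by (intro nn_integral_mono) (auto split: split_indicator)
  have lim: "(\<lambda>i. \<integral>\<^sup>+t. ennreal (norm (indicator S t *\<^sub>R f t - ?s i t)) \<partial>M) \<longlonglongrightarrow> 0"
    by (rule tendsto_sandwich[OF _ _ tendsto_const s(2)]) (use le in auto)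
  have eq: "(\<lambda>t. ennreal (norm (f t - s i t)) * indicator S t) =
     (\<lambda>t. ennreal (norm (indicator S t *\<^sub>R f t - ?s i t)))" for i
    by (auto split: split_indicator)
  \<comment> \<open>The given approximants need not vanish outside \<open>S\<close>. Multiplying by
    the indicator does not increase the error, and the integrals of the two versions differ by at
    most the sum of the two errors, so they have the same limit.\<close>
  have "(\<lambda>i. ennreal (norm (Bochner_Integration.simple_bochner_integral M (?s i) - Bochner_Integration.simple_bochner_integral M (s i)))) \<longlonglongrightarrow> 0"
  proof (rule tendsto_sandwich[OF _ _ tendsto_const])
    show "(\<lambda>i. (\<integral>\<^sup>+t. ennreal (norm (indicator S t *\<^sub>R f t - ?s i t)) \<partial>M)
      + (\<integral>\<^sup>+t. ennreal (norm (indicator S t *\<^sub>R f t - s i t)) \<partial>M)) \<longlonglongrightarrow> 0"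
      using tendsto_add[OF lim s(2)] by simp
    show "\<forall>\<^sub>F i in sequentially. ennreal (norm (Bochner_Integration.simple_bochner_integral M (?s i) - Bochner_Integration.simple_bochner_integral M (s i)))
      \<le> (\<integral>\<^sup>+t. ennreal (norm (indicator S t *\<^sub>R f t - ?s i t)) \<partial>M)
      + (\<integral>\<^sup>+t. ennreal (norm (indicator S t *\<^sub>R f t - s i t)) \<partial>M)"
      using simple_integral_diff_bound[OF f f rs' s(1)] by (intro always_eventually allI) simp
  qed simp
  then have "(\<lambda>i. norm (Bochner_Integration.simple_bochner_integral M (?s i) - Bochner_Integration.simple_bochner_integral M (s i))) \<longlonglongrightarrow> 0"
    by (subst (asm) ennreal_0[symmetric], subst (asm) tendsto_ennreal_iff) auto
  then have "(\<lambda>i. (Bochner_Integration.simple_bochner_integral M (?s i) - Bochner_Integration.simple_bochner_integral M (s i))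
     + Bochner_Integration.simple_bochner_integral M (s i)) \<longlonglongrightarrow> 0 + x"
    by (intro tendsto_add s(3)) (simp add: tendsto_norm_zero_iff)
  then have "(\<lambda>i. Bochner_Integration.simple_bochner_integral M (?s i)) \<longlonglongrightarrow> x" by simp
  with rs f lim show "has_vec_integral (restrict_space M S) f x"
    unfolding has_vec_integral_def strongly_measurable_restrict_space[OF S]
      nn_integral_restrict_space[OF S]
    by (intro conjI exI[where x=s] allI) (simp_all add: eq simple_bochner_integral_restrict_space[OF S])
qed

lemma vec_integrable_restrict_space:
  assumes S: "S \<inter> space M \<in> sets M"
  shows "vec_integrable (restrict_space M S) f \<longleftrightarrow> vec_integrable M (\<lambda>t. indicator S t *\<^sub>R f t)"
  unfolding vec_integrable_def has_vec_integral_restrict_space[OF S] ..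

lemma vec_integral_restrict_space:
  assumes S: "S \<inter> space M \<in> sets M"
  shows "vec_integral (restrict_space M S) f = vec_integral M (\<lambda>t. indicator S t *\<^sub>R f t)"
  unfolding vec_integral_def vec_integrable_def has_vec_integral_restrict_space[OF S] ..

text \<open>Bochner's criterion; completeness of the target enters from right to left, where a limit
  of integrals has to exist.\<close>

lemma vec_integrable_iff:
  fixes f :: "'a \<Rightarrow> 'b::banach"
  shows "vec_integrable M f \<longleftrightarrow> strongly_measurable M f \<and> integrable M (\<lambda>x. norm (f x))"
proof
  assume "vec_integrable M f"
  then obtain x where x: "has_vec_integral M f x" unfolding vec_integrable_def by blast
  then have f: "strongly_measurable M f" unfolding has_vec_integral_def by blast
  moreover have "integrable M (\<lambda>x. norm (f x))"
    using has_vec_integral_finite[OF x complete_measure_axioms] strongly_measurable_imp_borel[OF f]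
    by (intro integrableI_bounded) auto
  ultimately show "strongly_measurable M f \<and> integrable M (\<lambda>x. norm (f x))" by blast
next
  assume "strongly_measurable M f \<and> integrable M (\<lambda>x. norm (f x))"
  then show "vec_integrable M f"
    unfolding vec_integrable_def by (intro has_vec_integralI_bounded) (auto simp: integrable_iff_bounded)
qed

lemma has_vec_integral_vec_integral:
  "vec_integrable M f \<Longrightarrow> has_vec_integral M f (vec_integral M f)"
  using vec_integral_eq unfolding vec_integrable_def by auto

lemma vec_integrable_bound:
  fixes f :: "'a \<Rightarrow> 'b::banach"
  assumes f: "strongly_measurable M f" and w: "integrable M w" and le: "AE x in M. norm (f x) \<le> w x"
  shows "vec_integrable M f"
  unfolding vec_integrable_iff
proof
  show "integrable M (\<lambda>x. norm (f x))"
    by (rule Bochner_Integration.integrable_bound[OF w])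
       (use strongly_measurable_imp_borel[OF f] le in auto)
qed fact

lemma vec_integrable_strongly_measurable: "vec_integrable M f \<Longrightarrow> strongly_measurable M f"
  unfolding vec_integrable_def has_vec_integral_def by blast

lemma vec_integrable_norm:
  fixes f :: "'a \<Rightarrow> 'b::banach"
  shows "vec_integrable M f \<Longrightarrow> integrable M (\<lambda>x. norm (f x))"
  unfolding vec_integrable_iff by blast

lemma has_vec_integral_add:
  assumes f: "has_vec_integral M f x" and g: "has_vec_integral M g y"
  shows "has_vec_integral M (\<lambda>t. f t + g t) (x + y)"
proof -
  obtain s where s: "\<And>i::nat. Bochner_Integration.simple_bochner_integrable M (s i)"
     "(\<lambda>i. \<integral>\<^sup>+t. ennreal (norm (f t - s i t)) \<partial>M) \<longlonglongrightarrow> 0"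
     "(\<lambda>i. Bochner_Integration.simple_bochner_integral M (s i)) \<longlonglongrightarrow> x"
    and fm: "strongly_measurable M f"
    using f unfolding has_vec_integral_def by blast
  obtain s' where s': "\<And>i::nat. Bochner_Integration.simple_bochner_integrable M (s' i)"
     "(\<lambda>i. \<integral>\<^sup>+t. ennreal (norm (g t - s' i t)) \<partial>M) \<longlonglongrightarrow> 0"
     "(\<lambda>i. Bochner_Integration.simple_bochner_integral M (s' i)) \<longlonglongrightarrow> y"
    and gm: "strongly_measurable M g"
    using g unfolding has_vec_integral_def by blast
  have [measurable]: "(\<lambda>x. f x - s i x) \<in> borel_measurable M" "(\<lambda>x. g x - s' i x) \<in> borel_measurable M" for i
    by (intro strongly_measurable_imp_borel strongly_measurable_diff fm gm
        simple_bochner_integrable_strongly_measurable s s')+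
  have "(\<lambda>i. \<integral>\<^sup>+t. ennreal (norm (f t + g t - (s i t + s' i t))) \<partial>M) \<longlonglongrightarrow> 0"
  proof (rule tendsto_sandwich[OF _ _ tendsto_const])
    show "(\<lambda>i. (\<integral>\<^sup>+t. ennreal (norm (f t - s i t)) \<partial>M) + (\<integral>\<^sup>+t. ennreal (norm (g t - s' i t)) \<partial>M)) \<longlonglongrightarrow> 0"
      using tendsto_add[OF s(2) s'(2)] by simp
    have "(\<integral>\<^sup>+t. ennreal (norm (f t + g t - (s i t + s' i t))) \<partial>M)
      \<le> (\<integral>\<^sup>+t. ennreal (norm (f t - s i t)) + ennreal (norm (g t - s' i t)) \<partial>M)" for i
    proof (rule nn_integral_mono)
      show "ennreal (norm (f t + g t - (s i t + s' i t))) \<le> ennreal (norm (f t - s i t)) + ennreal (norm (g t - s' i t))" for t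
        using norm_triangle_ineq[of "f t - s i t" "g t - s' i t"]
        by (simp flip: ennreal_plus add: algebra_simps)
    qed
    then show "\<forall>\<^sub>F i in sequentially. (\<integral>\<^sup>+t. ennreal (norm (f t + g t - (s i t + s' i t))) \<partial>M) \<le>
       (\<integral>\<^sup>+t. ennreal (norm (f t - s i t)) \<partial>M) + (\<integral>\<^sup>+t. ennreal (norm (g t - s' i t)) \<partial>M)"
      by (intro always_eventually allI) (simp add: nn_integral_add)
  qed simp
  moreover have "(\<lambda>i. Bochner_Integration.simple_bochner_integral M (\<lambda>t. s i t + s' i t)) \<longlonglongrightarrow> x + y"
    unfolding simple_bochner_integral_add[OF s(1) s'(1)] by (intro tendsto_add s s')
  moreover have "Bochner_Integration.simple_bochner_integrable M (\<lambda>t. s i t + s' i t)" for i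
    by (rule simple_bochner_integrable_compose2[OF _ s(1) s'(1)]) simp
  ultimately show ?thesis
    unfolding has_vec_integral_def using strongly_measurable_add[OF fm gm]
    by (intro conjI exI[of _ "\<lambda>i t. s i t + s' i t"] allI)
qed

lemma has_vec_integral_bounded_linear:
  assumes L: "bounded_linear L" and f: "has_vec_integral M f x"
  shows "has_vec_integral M (\<lambda>t. L (f t)) (L x)"
proof -
  interpret L: bounded_linear L by fact
  obtain s where s: "\<And>i::nat. Bochner_Integration.simple_bochner_integrable M (s i)"
     "(\<lambda>i. \<integral>\<^sup>+t. ennreal (norm (f t - s i t)) \<partial>M) \<longlonglongrightarrow> 0"
     "(\<lambda>i. Bochner_Integration.simple_bochner_integral M (s i)) \<longlonglongrightarrow> x"
    and fm: "strongly_measurable M f"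
    using f unfolding has_vec_integral_def by blast
  obtain K where K: "0 < K" "\<And>x. norm (L x) \<le> norm x * K"
    using L.pos_bounded by blast
  have [measurable]: "(\<lambda>x. f x - s i x) \<in> borel_measurable M" for i
    by (intro strongly_measurable_imp_borel strongly_measurable_diff fm
        simple_bochner_integrable_strongly_measurable s)+
  have "(\<lambda>i. \<integral>\<^sup>+t. ennreal (norm (L (f t) - L (s i t))) \<partial>M) \<longlonglongrightarrow> 0"
  proof (rule tendsto_sandwich[OF _ _ tendsto_const])
    show "(\<lambda>i. ennreal K * (\<integral>\<^sup>+t. ennreal (norm (f t - s i t)) \<partial>M)) \<longlonglongrightarrow> 0"
      using ennreal_tendsto_cmult[OF _ s(2), of "ennreal K"] by simp
    have "(\<integral>\<^sup>+t. ennreal (norm (L (f t) - L (s i t))) \<partial>M)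
      \<le> (\<integral>\<^sup>+t. ennreal K * ennreal (norm (f t - s i t)) \<partial>M)" for i
      using K by (intro nn_integral_mono) (auto simp flip: ennreal_mult L.diff simp: mult.commute intro!: ennreal_leI)
    then show "\<forall>\<^sub>F i in sequentially. (\<integral>\<^sup>+t. ennreal (norm (L (f t) - L (s i t))) \<partial>M) \<le>
       ennreal K * (\<integral>\<^sup>+t. ennreal (norm (f t - s i t)) \<partial>M)"
      by (intro always_eventually allI) (simp add: nn_integral_cmult)
  qed simp
  moreover have "(\<lambda>i. Bochner_Integration.simple_bochner_integral M (\<lambda>t. L (s i t))) \<longlonglongrightarrow> L x"
    unfolding simple_bochner_integral_linear[OF L.linear_axioms s(1)] by (intro L.tendsto s)
  moreover have "Bochner_Integration.simple_bochner_integrable M (\<lambda>t. L (s i t))" for i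
    by (rule simple_bochner_integrable_compose2[of "\<lambda>x y. L x", OF _ s(1) s(1)]) (simp add: L.zero)
  ultimately show ?thesis
    unfolding has_vec_integral_def using strongly_measurable_bounded_linear[OF L fm]
    by (intro conjI exI[of _ "\<lambda>i t. L (s i t)"] allI)
qed

lemma vec_integrable_add: "vec_integrable M f \<Longrightarrow> vec_integrable M g \<Longrightarrow> vec_integrable M (\<lambda>t. f t + g t)"
  unfolding vec_integrable_def by (auto intro: has_vec_integral_add)

lemma vec_integral_add:
  "vec_integrable M f \<Longrightarrow> vec_integrable M g \<Longrightarrow>
   vec_integral M (\<lambda>t. f t + g t) = vec_integral M f + vec_integral M g"
  by (intro vec_integral_eq has_vec_integral_add has_vec_integral_vec_integral)

lemma vec_integrable_scaleR: "vec_integrable M f \<Longrightarrow> vec_integrable M (\<lambda>t. c *\<^sub>R f t)"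
  unfolding vec_integrable_def by (auto intro: has_vec_integral_bounded_linear[OF bounded_linear_scaleR_right])

lemma vec_integral_scaleR:
  "vec_integrable M f \<Longrightarrow> vec_integral M (\<lambda>t. c *\<^sub>R f t) = c *\<^sub>R vec_integral M f"
  by (intro vec_integral_eq has_vec_integral_bounded_linear[OF bounded_linear_scaleR_right] has_vec_integral_vec_integral)

lemma vec_integrable_diff: "vec_integrable M f \<Longrightarrow> vec_integrable M g \<Longrightarrow> vec_integrable M (\<lambda>t. f t - g t)"
  using vec_integrable_add[OF _ vec_integrable_scaleR[of g "-1"]] by simp

lemma vec_integral_diff:
  "vec_integrable M f \<Longrightarrow> vec_integrable M g \<Longrightarrow>
   vec_integral M (\<lambda>t. f t - g t) = vec_integral M f - vec_integral M g"
  using vec_integral_add[OF _ vec_integrable_scaleR[of g "-1"]] vec_integral_scaleR[of g "-1"] by simp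

lemma
  fixes r :: "'a \<Rightarrow> real"
  assumes "integrable M r"
  shows vec_integrable_scaleR_const: "vec_integrable M (\<lambda>t. r t *\<^sub>R v)"
    and vec_integral_scaleR_const: "vec_integral M (\<lambda>t. r t *\<^sub>R v) = integral\<^sup>L M r *\<^sub>R v"
proof -
  have "has_vec_integral M (\<lambda>t. r t *\<^sub>R v) (integral\<^sup>L M r *\<^sub>R v)"
    using assms by (intro has_vec_integral_bounded_linear[OF bounded_linear_scaleR_left]
        has_vec_integral_real has_bochner_integral_integrable)
  then show "vec_integrable M (\<lambda>t. r t *\<^sub>R v)" "vec_integral M (\<lambda>t. r t *\<^sub>R v) = integral\<^sup>L M r *\<^sub>R v"
    unfolding vec_integrable_def by (auto intro: vec_integral_eq)
qed

lemma norm_vec_integral_diff_le: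
  fixes f g :: "'a \<Rightarrow> 'b::banach"
  assumes f: "vec_integrable M f" and g: "vec_integrable M g"
  shows "norm (vec_integral M f - vec_integral M g) \<le> (\<integral>x. norm (f x - g x) \<partial>M)"
proof -
  have "ennreal (norm (vec_integral M f - vec_integral M g)) \<le> (\<integral>\<^sup>+x. norm (f x - g x) \<partial>M)"
    by (intro has_vec_integral_diff_bound has_vec_integral_vec_integral f g)
  also have "\<dots> = ennreal (\<integral>x. norm (f x - g x) \<partial>M)"
    by (intro nn_integral_eq_integral vec_integrable_norm vec_integrable_diff f g) auto
  finally show ?thesis by (simp add: integral_nonneg_AE)
qed

lemma norm_vec_integral_le:
  fixes f :: "'a \<Rightarrow> 'b::banach"
  assumes f: "vec_integrable M f"
  shows "norm (vec_integral M f) \<le> (\<integral>x. norm (f x) \<partial>M)"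
  using norm_vec_integral_diff_le[OF f vec_integrable_scaleR[OF f, of 0]] vec_integral_scaleR[OF f, of 0] by simp

lemma vec_integral_cong_AE:
  fixes f g :: "'a \<Rightarrow> 'b::banach"
  assumes f: "vec_integrable M f" and eq: "AE x in M. f x = g x"
  shows "vec_integrable M g" "vec_integral M g = vec_integral M f"
proof -
  have "vec_integrable M g"
    by (rule vec_integrable_bound[OF strongly_measurable_cong_AE[OF eq] vec_integrable_norm[OF f]])
       (use eq vec_integrable_strongly_measurable[OF f] in auto)
  moreover have "norm (vec_integral M g - vec_integral M f) \<le> (\<integral>x. norm (g x - f x) \<partial>M)"
    by (intro norm_vec_integral_diff_le f calculation)
  moreover have "(\<integral>x. norm (g x - f x) \<partial>M) = 0"
    using eq by (intro integral_eq_zero_AE) auto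
  ultimately show "vec_integrable M g" "vec_integral M g = vec_integral M f" by auto
qed

lemma vec_integral_dominated_convergence:
  fixes f :: "'a \<Rightarrow> 'b::banach" and s :: "nat \<Rightarrow> 'a \<Rightarrow> 'b"
  assumes f: "strongly_measurable M f" and s: "\<And>i. strongly_measurable M (s i)" and w: "integrable M w"
    and lim: "AE x in M. (\<lambda>i. s i x) \<longlonglongrightarrow> f x" and bound: "\<And>i. AE x in M. norm (s i x) \<le> w x"
  shows "vec_integrable M f" "\<And>i. vec_integrable M (s i)"
    "(\<lambda>i. vec_integral M (s i)) \<longlonglongrightarrow> vec_integral M f"
proof -
  have "AE x in M. \<forall>i. norm (s i x) \<le> w x"
    using bound by (simp add: AE_all_countable)
  with lim have fb: "AE x in M. norm (f x) \<le> w x"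
  proof eventually_elim
    fix x assume "(\<lambda>i. s i x) \<longlonglongrightarrow> f x" "\<forall>i. norm (s i x) \<le> w x"
    then show "norm (f x) \<le> w x" by (intro LIMSEQ_le_const2[OF tendsto_norm]) auto
  qed
  show fi: "vec_integrable M f" by (rule vec_integrable_bound[OF f w fb])
  show si: "vec_integrable M (s i)" for i by (rule vec_integrable_bound[OF s w bound])
  have "(\<lambda>i. \<integral>x. norm (s i x - f x) \<partial>M) \<longlonglongrightarrow> (\<integral>x. 0 \<partial>M)"
  proof (rule integral_dominated_convergence[where w="\<lambda>x. 2 * w x"])
    show "(\<lambda>x. norm (s i x - f x)) \<in> borel_measurable M" for i
      using strongly_measurable_imp_borel[OF strongly_measurable_diff[OF s f]] by measurable
    show "AE x in M. (\<lambda>i. norm (s i x - f x)) \<longlonglongrightarrow> 0"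
      using lim by eventually_elim (simp add: LIM_zero_iff tendsto_norm_zero_iff)
    show "AE x in M. norm (norm (s i x - f x)) \<le> 2 * w x" for i
      using fb bound[of i]
    proof eventually_elim
      case (elim x)
      then show ?case using norm_triangle_ineq4[of "s i x" "f x"] by simp
    qed
  qed (use w in auto)
  then have int_lim: "(\<lambda>i. \<integral>x. norm (s i x - f x) \<partial>M) \<longlonglongrightarrow> 0" by simp
  have "norm (vec_integral M (s i) - vec_integral M f) \<le> (\<integral>x. norm (s i x - f x) \<partial>M)" for i
    by (intro norm_vec_integral_diff_le fi si)
  then have "(\<lambda>i. norm (vec_integral M (s i) - vec_integral M f)) \<longlonglongrightarrow> 0"
    by (intro tendsto_sandwich[OF _ _ tendsto_const int_lim] always_eventually allI norm_ge_zero)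
  then show "(\<lambda>i. vec_integral M (s i)) \<longlonglongrightarrow> vec_integral M f"
    by (simp add: LIM_zero_iff tendsto_norm_zero_iff)
qed

lemma vec_integrable_mult_bounded:
  fixes f :: "'a \<Rightarrow> 'b::banach" and r :: "'a \<Rightarrow> real"
  assumes f: "vec_integrable M f" and r: "r \<in> borel_measurable M" "\<And>x. \<bar>r x\<bar> \<le> C"
  shows "vec_integrable M (\<lambda>x. r x *\<^sub>R f x)"
proof (rule vec_integrable_bound)
  show "integrable M (\<lambda>x. C * norm (f x))" using vec_integrable_norm[OF f] by simp
  show "AE x in M. norm (r x *\<^sub>R f x) \<le> C * norm (f x)"
    using r(2) by (intro AE_I2) (auto intro: mult_right_mono)
qed (intro strongly_measurable_scaleR r vec_integrable_strongly_measurable f)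

text \<open>For a simple function \<open>s\<close> close to \<open>k\<close> in the mean, the integrals of \<open>k\<close> over the level
  sets of \<open>s\<close> vanish, so that \<open>s\<close> is small in the mean itself.\<close>

lemma vec_integral_sets_eq_0_imp_AE_0:
  fixes k :: "'a \<Rightarrow> 'b::banach"
  assumes k: "vec_integrable M k"
    and zero: "\<And>A. A \<in> sets M \<Longrightarrow> vec_integral M (\<lambda>x. indicator A x *\<^sub>R k x) = 0"
  shows "AE x in M. k x = 0"
proof -
  obtain s where s: "\<And>i::nat. Bochner_Integration.simple_bochner_integrable M (s i)"
     "(\<lambda>i. \<integral>\<^sup>+t. ennreal (norm (k t - s i t)) \<partial>M) \<longlonglongrightarrow> 0"
    using k unfolding vec_integrable_def has_vec_integral_def by blast
  have si: "vec_integrable M (s i)" for i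
    unfolding vec_integrable_def has_vec_integral_def
    using s(1)[of i] simple_bochner_integrable_strongly_measurable[OF s(1)[of i]]
    by (intro exI[of _ "Bochner_Integration.simple_bochner_integral M (s i)"] conjI exI[of _ "\<lambda>_. s i"]) auto
  define e where "e i = (\<integral>x. norm (k x - s i x) \<partial>M)" for i
  have "(\<integral>\<^sup>+t. ennreal (norm (k t - s i t)) \<partial>M) = ennreal (e i)" for i
    unfolding e_def by (intro nn_integral_eq_integral vec_integrable_norm vec_integrable_diff k si) auto
  with s(2) have e_lim: "e \<longlonglongrightarrow> 0"
    using tendsto_ennreal_iff[of e sequentially 0] by (simp add: e_def integral_nonneg_AE)
  have s_le: "(\<integral>x. norm (s i x) \<partial>M) \<le> e i" for i
  proof -
    have sf: "simple_function M (s i)" using s(1)[of i] by (auto elim: simple_bochner_integrable.cases)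
    let ?Y = "s i ` space M"
    have fin: "finite ?Y" using sf by (rule simple_functionD)
    define A where "A y = s i -` {y} \<inter> space M" for y
    have A: "A y \<in> sets M" for y unfolding A_def by (rule simple_functionD(2)[OF sf])
    note [measurable] = A
    have int_s: "vec_integrable M (\<lambda>x. indicator (A y) x *\<^sub>R s i x)" for y
      by (rule vec_integrable_mult_bounded[OF si, of _ 1]) (auto split: split_indicator)
    have int_k: "vec_integrable M (\<lambda>x. indicator (A y) x *\<^sub>R k x)" for y
      by (rule vec_integrable_mult_bounded[OF k, of _ 1]) (auto split: split_indicator)
    have nint: "integrable M (\<lambda>x. indicator (A y) x * norm (s i x))" for y
      using vec_integrable_norm[OF int_s[of y]] by simp
    have dint: "integrable M (\<lambda>x. indicator (A y) x * norm (s i x - k x))" for y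
      using vec_integrable_norm[OF vec_integrable_diff[OF int_s[of y] int_k[of y]]]
      by (simp flip: scaleR_diff_right)
    have ind: "(\<Sum>y\<in>?Y. indicator (A y) x * c) = c" if "x \<in> space M" for x and c :: real
    proof -
      have "(\<Sum>y\<in>?Y. indicator (A y) x * c) = (\<Sum>y\<in>?Y. if y = s i x then c else 0)"
        using that by (intro sum.cong) (auto simp: A_def split: split_indicator)
      also have "\<dots> = c" using that fin by simp
      finally show ?thesis .
    qed
    have each: "(\<integral>x. indicator (A y) x * norm (s i x) \<partial>M) \<le> (\<integral>x. indicator (A y) x * norm (s i x - k x) \<partial>M)" for y
    \<comment> \<open>The level set of 0 may have infinite measure, so its indicator need not be
      integrable; there the left side is simply 0. For every other value integrability of
      \<open>s i\<close> forces finite measure.\<close>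
    proof (cases "y = 0")
      case True
      have "(\<integral>x. indicator (A y) x * norm (s i x) \<partial>M) = 0"
        by (intro integral_eq_zero_AE AE_I2) (auto simp: A_def True split: split_indicator)
      moreover have "0 \<le> (\<integral>x. indicator (A y) x * norm (s i x - k x) \<partial>M)"
        by (intro integral_nonneg_AE) auto
      ultimately show ?thesis by simp
    next
      case False
      have sy: "indicator (A y) x * norm (s i x) = indicator (A y) x * norm y"
         "indicator (A y) x *\<^sub>R s i x = indicat_real (A y) x *\<^sub>R y" for x
        by (auto simp: A_def split: split_indicator)
      have "integrable M (\<lambda>x. inverse (norm y) * (indicator (A y) x * norm (s i x)))"
        using nint by simp
      then have iA: "integrable M (indicat_real (A y))"
        unfolding sy using False by (simp add: field_simps)
      have "(\<integral>x. indicator (A y) x * norm (s i x) \<partial>M) = norm (integral\<^sup>L M (indicat_real (A y)) *\<^sub>R y)"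
        unfolding sy by (simp add: abs_of_nonneg integral_nonneg_AE)
      \<comment> \<open>The integral of \<open>k\<close> over the level set is 0 by assumption, so
        it can be subtracted at no cost; this turns the size of \<open>s i\<close> into its distance
        from \<open>k\<close>.\<close>
      also have "\<dots> = norm (vec_integral M (\<lambda>x. indicator (A y) x *\<^sub>R s i x) - vec_integral M (\<lambda>x. indicator (A y) x *\<^sub>R k x))"
        unfolding sy zero[OF A] vec_integral_scaleR_const[OF iA] by simp
      also have "\<dots> \<le> (\<integral>x. norm (indicator (A y) x *\<^sub>R s i x - indicator (A y) x *\<^sub>R k x) \<partial>M)"
        by (intro norm_vec_integral_diff_le int_s int_k)
      also have "\<dots> = (\<integral>x. indicator (A y) x * norm (s i x - k x) \<partial>M)"
        by (simp flip: scaleR_diff_right)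
      finally show ?thesis .
    qed
    have "(\<integral>x. norm (s i x) \<partial>M) = (\<integral>x. (\<Sum>y\<in>?Y. indicator (A y) x * norm (s i x)) \<partial>M)"
      by (intro Bochner_Integration.integral_cong) (auto simp: ind)
    also have "\<dots> = (\<Sum>y\<in>?Y. \<integral>x. indicator (A y) x * norm (s i x) \<partial>M)"
      by (intro Bochner_Integration.integral_sum nint)
    also have "\<dots> \<le> (\<Sum>y\<in>?Y. \<integral>x. indicator (A y) x * norm (s i x - k x) \<partial>M)"
      by (intro sum_mono each)
    also have "\<dots> = (\<integral>x. (\<Sum>y\<in>?Y. indicator (A y) x * norm (s i x - k x)) \<partial>M)"
      by (intro Bochner_Integration.integral_sum[symmetric] dint)
    also have "\<dots> = e i"
      unfolding e_def by (intro Bochner_Integration.integral_cong) (auto simp: ind norm_minus_commute)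
    finally show ?thesis .
  qed
  have "(\<integral>x. norm (k x) \<partial>M) \<le> 2 * e i" for i
  proof -
    have "(\<integral>x. norm (k x) \<partial>M) \<le> (\<integral>x. norm (k x - s i x) + norm (s i x) \<partial>M)"
    proof (rule integral_mono)
      show "norm (k x) \<le> norm (k x - s i x) + norm (s i x)" for x
        using norm_triangle_ineq[of "k x - s i x" "s i x"] by simp
    qed (intro vec_integrable_norm Bochner_Integration.integrable_add vec_integrable_diff k si)+
    also have "\<dots> = e i + (\<integral>x. norm (s i x) \<partial>M)"
      unfolding e_def by (intro Bochner_Integration.integral_add vec_integrable_norm vec_integrable_diff k si)
    finally show ?thesis using s_le[of i] by simp
  qed
  moreover have "(\<lambda>i. 2 * e i) \<longlonglongrightarrow> 0" using tendsto_mult_right_zero[OF e_lim] .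
  ultimately have "(\<integral>x. norm (k x) \<partial>M) \<le> 0"
    using LIMSEQ_le_const[of "\<lambda>i. 2 * e i" 0] by blast
  then have "(\<integral>x. norm (k x) \<partial>M) = 0" by (intro antisym integral_nonneg_AE) auto
  then have "AE x in M. norm (k x) = 0"
    using integral_nonneg_eq_0_iff_AE[OF vec_integrable_norm[OF k]] by auto
  then show ?thesis by simp
qed

end

section \<open>Smooth bump functions\<close>

text \<open>Smoothness is cut down to finite order so that closure properties can be proved by
  induction on \<open>n\<close>. Note the shift: order \<open>n\<close> means that the derivatives
  of orders 0 to \<open>n\<close> are differentiable, so \<open>n + 1\<close> derivatives
  exist.\<close>

definition diff_upto :: "nat \<Rightarrow> (real \<Rightarrow> real) \<Rightarrow> bool" where
  "diff_upto n f \<longleftrightarrow> (\<forall>k\<le>n. \<forall>x. (deriv ^^ k) f field_differentiable at x)"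

lemma diff_upto_0: "diff_upto 0 f \<longleftrightarrow> (\<forall>x. f field_differentiable at x)"
  by (simp add: diff_upto_def)

lemma diff_upto_Suc: "diff_upto (Suc n) f \<longleftrightarrow> (\<forall>x. f field_differentiable at x) \<and> diff_upto n (deriv f)"
proof
  assume f: "diff_upto (Suc n) f"
  show "(\<forall>x. f field_differentiable at x) \<and> diff_upto n (deriv f)"
    unfolding diff_upto_def
  proof (intro conjI allI impI)
    show "f field_differentiable at x" for x
      using f[unfolded diff_upto_def, rule_format, of 0 x] by simp
    show "(deriv ^^ k) (deriv f) field_differentiable at x" if "k \<le> n" for k x
      using f[unfolded diff_upto_def, rule_format, of "Suc k" x] that by (simp add: funpow_swap1)
  qed
next
  assume f: "(\<forall>x. f field_differentiable at x) \<and> diff_upto n (deriv f)"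
  show "diff_upto (Suc n) f"
    unfolding diff_upto_def
  proof (intro allI impI)
    fix k x assume "k \<le> Suc n"
    with f show "(deriv ^^ k) f field_differentiable at x"
      unfolding diff_upto_def by (cases k) (auto simp: funpow_swap1)
  qed
qed

lemma diff_upto_mono: "diff_upto n f \<Longrightarrow> m \<le> n \<Longrightarrow> diff_upto m f"
  unfolding diff_upto_def by auto

lemma diff_upto_imp_differentiable: "diff_upto n f \<Longrightarrow> f field_differentiable at x"
  using diff_upto_mono[of n f 0] by (simp add: diff_upto_0)

lemma diff_upto_SucI:
  assumes "\<And>x. (f has_field_derivative f' x) (at x)" "diff_upto n f'"
  shows "diff_upto (Suc n) f"
proof -
  have "deriv f = f'" using assms(1) by (intro ext DERIV_imp_deriv)
  then show ?thesis using assms by (auto simp: diff_upto_Suc field_differentiable_def)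
qed

lemma diff_upto_has_derivative:
  "diff_upto n f \<Longrightarrow> (f has_field_derivative deriv f x) (at x)"
  using diff_upto_imp_differentiable field_differentiable_derivI by blast

lemma diff_upto_add:
  "diff_upto n f \<Longrightarrow> diff_upto n g \<Longrightarrow> diff_upto n (\<lambda>x. f x + g x)"
proof (induction n arbitrary: f g)
  case 0
  then show ?case by (auto simp: diff_upto_0 intro: field_differentiable_add)
next
  case (Suc n)
  show ?case
  proof (rule diff_upto_SucI[where f'="\<lambda>x. deriv f x + deriv g x"])
    show "((\<lambda>x. f x + g x) has_real_derivative deriv f x + deriv g x) (at x)" for x
      by (intro DERIV_add diff_upto_has_derivative[OF Suc.prems(1)] diff_upto_has_derivative[OF Suc.prems(2)])
    show "diff_upto n (\<lambda>x. deriv f x + deriv g x)"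
      using Suc.prems by (intro Suc.IH) (auto simp: diff_upto_Suc)
  qed
qed

lemma diff_upto_mult:
  "diff_upto n f \<Longrightarrow> diff_upto n g \<Longrightarrow> diff_upto n (\<lambda>x. f x * g x)"
proof (induction n arbitrary: f g)
  case 0
  then show ?case by (auto simp: diff_upto_0 intro: field_differentiable_mult)
next
  case (Suc n)
  show ?case
  proof (rule diff_upto_SucI[where f'="\<lambda>x. deriv f x * g x + deriv g x * f x"])
    show "((\<lambda>x. f x * g x) has_real_derivative deriv f x * g x + deriv g x * f x) (at x)" for x
      by (intro DERIV_mult diff_upto_has_derivative[OF Suc.prems(1)] diff_upto_has_derivative[OF Suc.prems(2)])
    have "diff_upto n f" "diff_upto n g" using Suc.prems by (auto elim: diff_upto_mono)
    then show "diff_upto n (\<lambda>x. deriv f x * g x + deriv g x * f x)"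
      using Suc.prems by (intro diff_upto_add Suc.IH) (auto simp: diff_upto_Suc)
  qed
qed

lemma diff_upto_const: "diff_upto n (\<lambda>x. c)"
proof (induction n arbitrary: c)
  case (Suc n)
  show ?case by (rule diff_upto_SucI[where f'="\<lambda>_. 0"]) (auto intro: Suc)
qed (simp add: diff_upto_0)

lemma diff_upto_affine:
  "diff_upto n f \<Longrightarrow> diff_upto n (\<lambda>x. f (a * x + b))"
proof (induction n arbitrary: f)
  case 0
  have "((\<lambda>x. f (a * x + b)) has_real_derivative deriv f (a * x + b) * a) (at x)" for x
    by (rule DERIV_chain2[OF diff_upto_has_derivative[OF 0]]) (auto intro!: derivative_eq_intros)
  then show ?case by (auto simp: diff_upto_0 field_differentiable_def)
next
  case (Suc n)
  show ?case
  proof (rule diff_upto_SucI[where f'="\<lambda>x. deriv f (a * x + b) * a"])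
    show "((\<lambda>x. f (a * x + b)) has_real_derivative deriv f (a * x + b) * a) (at x)" for x
      by (rule DERIV_chain2[OF diff_upto_has_derivative[OF Suc.prems]]) (auto intro!: derivative_eq_intros)
    show "diff_upto n (\<lambda>x. deriv f (a * x + b) * a)"
      by (intro diff_upto_mult diff_upto_const Suc.IH) (use Suc.prems in \<open>simp add: diff_upto_Suc\<close>)
  qed
qed

lemma test_function_iff:
  "test_function T \<phi> \<longleftrightarrow> (\<forall>n. diff_upto n \<phi>) \<and> (\<exists>K. compact K \<and> K \<subseteq> {0<..<T} \<and> (\<forall>x. x \<notin> K \<longrightarrow> \<phi> x = 0))"
  unfolding test_function_def diff_upto_def by auto

text \<open>The power \<open>y ^ k\<close> is slack for the induction on \<open>P\<close>: in
  \<open>pCons a P\<close> the extra factor \<open>y\<close> is absorbed into it, and the constant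
  term leaves a plain power against an exponential.\<close>

lemma power_poly_exp_tendsto_0:
  fixes l :: real
  assumes "0 < l"
  shows "((\<lambda>y. y ^ k * poly P y * exp (- (l * y))) \<longlongrightarrow> 0) at_top"
proof (induction P arbitrary: k)
  case 0
  then show ?case by simp
next
  case (pCons a P)
  have "filterlim (\<lambda>y. l * y) at_top at_top"
    using assms by (intro filterlim_tendsto_pos_mult_at_top[OF tendsto_const _ filterlim_ident])
  from filterlim_compose[OF tendsto_power_div_exp_0[of k] this]
  have "((\<lambda>y. (a / l ^ k) * ((l * y) ^ k / exp (l * y))) \<longlongrightarrow> (a / l ^ k) * 0) at_top"
    by (intro tendsto_mult tendsto_const)
  moreover have "(a / l ^ k) * ((l * y) ^ k / exp (l * y)) = y ^ k * a * exp (- (l * y))" for y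
    using assms by (simp add: exp_minus field_simps)
  ultimately have "((\<lambda>y. y ^ k * a * exp (- (l * y)) + y ^ Suc k * poly P y * exp (- (l * y))) \<longlongrightarrow> 0 + 0) at_top"
    by (intro tendsto_add pCons.IH) simp
  then show ?case by (simp add: algebra_simps)
qed

text \<open>The classical flat function is the case \<open>P = 1\<close>. Allowing a polynomial in
  \<open>1 / x\<close> makes the class closed under differentiation, so smoothness follows by
  induction for all \<open>P\<close> at once.\<close>

definition flat_poly :: "real \<Rightarrow> real poly \<Rightarrow> real \<Rightarrow> real" where
  "flat_poly l P x = (if 0 < x then poly P (1 / x) * exp (- (l / x)) else 0)"

text \<open>\<open>[:0, 0, 1:]\<close> is the square of the variable: differentiating
  \<open>P(1/x) exp(-l/x)\<close> brings out \<open>1/x^2\<close> times \<open>l P - P'\<close>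
  taken at \<open>1/x\<close>. At 0 the right difference quotient is \<open>y P(y) exp(-l y)\<close>
  with \<open>y = 1/h\<close>, which tends to 0, and the left one is 0.\<close>

lemma flat_poly_has_derivative:
  assumes l: "0 < l"
  shows "(flat_poly l P has_field_derivative flat_poly l ([:0, 0, 1:] * (smult l P - pderiv P)) x) (at x)"
proof (cases x "0 :: real" rule: linorder_cases)
  case less
  have "((\<lambda>_. 0) has_field_derivative 0) (at x)" by simp
  then have "(flat_poly l P has_field_derivative 0) (at x)"
    by (rule has_field_derivative_transform_within_open[of _ _ _ "{..<0}"])
       (use less in \<open>auto simp: flat_poly_def\<close>)
  then show ?thesis using less by (simp add: flat_poly_def)
next
  case equal
  have "((\<lambda>y. y ^ 1 * poly P y * exp (- (l * y))) \<longlongrightarrow> 0) at_top"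
    by (rule power_poly_exp_tendsto_0[OF l])
  then have "((\<lambda>h. inverse h * poly P (inverse h) * exp (- (l * inverse h))) \<longlongrightarrow> 0) (at_right 0)"
    using filterlim_compose[OF _ filterlim_inverse_at_top_right] by force
  moreover have "\<forall>\<^sub>F h in at_right 0. inverse h * poly P (inverse h) * exp (- (l * inverse h)) = (flat_poly l P (0 + h) - flat_poly l P 0) / h"
    unfolding eventually_at_right_field
    by (intro exI[of _ 1]) (auto simp: flat_poly_def field_simps)
  ultimately have "((\<lambda>h. (flat_poly l P (0 + h) - flat_poly l P 0) / h) \<longlongrightarrow> 0) (at_right 0)"
    by (rule Lim_transform_eventually)
  moreover have "\<forall>\<^sub>F h in at_left 0. 0 = (flat_poly l P (0 + h) - flat_poly l P 0) / h"
    unfolding eventually_at_left_field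
    by (intro exI[of _ "-1"]) (auto simp: flat_poly_def)
  then have "((\<lambda>h. (flat_poly l P (0 + h) - flat_poly l P 0) / h) \<longlongrightarrow> 0) (at_left 0)"
    by (rule Lim_transform_eventually[OF tendsto_const])
  ultimately have "((\<lambda>h. (flat_poly l P (0 + h) - flat_poly l P 0) / h) \<longlongrightarrow> 0) (at 0)"
    using filterlim_split_at by blast
  then have "(flat_poly l P has_field_derivative 0) (at 0)"
    unfolding DERIV_def .
  then show ?thesis using equal by (simp add: flat_poly_def)
next
  case greater
  have "((\<lambda>x. poly P (1 / x) * exp (- (l / x))) has_field_derivative
     flat_poly l ([:0, 0, 1:] * (smult l P - pderiv P)) x) (at x)"
    using greater
    by (auto intro!: derivative_eq_intros poly_DERIV simp: flat_poly_def field_simps power2_eq_square)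
  then show ?thesis
    by (rule has_field_derivative_transform_within_open[of _ _ _ "{0<..}"])
       (use greater in \<open>auto simp: flat_poly_def\<close>)
qed

lemma diff_upto_flat_poly: "0 < l \<Longrightarrow> diff_upto n (flat_poly l P)"
proof (induction n arbitrary: P)
  case 0
  then show ?case using flat_poly_has_derivative by (auto simp: diff_upto_0 field_differentiable_def)
next
  case (Suc n)
  then show ?case using diff_upto_SucI flat_poly_has_derivative by blast
qed

text \<open>Product of a flat function rising at \<open>p\<close> and a mirrored one falling at
  \<open>q\<close>. The parameter \<open>l\<close> stays free because the bump tends to the
  indicator of the open interval as \<open>l\<close> tends to 0.\<close>

definition bump :: "real \<Rightarrow> real \<Rightarrow> real \<Rightarrow> real \<Rightarrow> real" where
  "bump l p q x = (if p < x \<and> x < q then exp (- (l / (x - p))) * exp (- (l / (q - x))) else 0)"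

lemma bump_bounds:
  assumes "0 < l" shows "0 \<le> bump l p q x" "bump l p q x \<le> 1"
  using assms by (auto simp: bump_def intro!: mult_le_one)

lemma test_function_bump:
  assumes "0 < l" "0 < p" "q < T" shows "test_function T (bump l p q)"
  unfolding test_function_iff
proof (intro conjI allI exI[of _ "{p..q}"] impI)
  have "bump l p q = (\<lambda>x. flat_poly l 1 (1 * x + (-p)) * flat_poly l 1 ((-1) * x + q))"
    by (auto simp: bump_def flat_poly_def)
  then show "diff_upto n (bump l p q)" for n
    by (simp only:) (intro diff_upto_mult diff_upto_affine diff_upto_flat_poly assms)
qed (use assms in \<open>auto simp: bump_def\<close>)

section \<open>Test functions: supports, derivatives and primitives\<close>

lemma test_function_continuous: "test_function T \<phi> \<Longrightarrow> continuous_on S \<phi>"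
  unfolding test_function_iff
  by (meson continuous_at_imp_continuous_on diff_upto_imp_differentiable field_differentiable_imp_continuous_at)

lemma test_function_has_derivative: "test_function T \<phi> \<Longrightarrow> (\<phi> has_field_derivative deriv \<phi> x) (at x)"
  unfolding test_function_iff using diff_upto_has_derivative by blast

lemma test_function_support:
  assumes T: "0 < T" and \<phi>: "test_function T \<phi>"
  obtains p q where "0 < p" "p < q" "q < T" "\<And>x. x \<le> p \<or> q \<le> x \<Longrightarrow> \<phi> x = 0"
proof -
  obtain K where K: "compact K" "K \<subseteq> {0<..<T}" "\<And>x. x \<notin> K \<Longrightarrow> \<phi> x = 0"
    using \<phi> unfolding test_function_iff by blast
  obtain a b where ab: "0 < a" "a \<le> b" "b < T" "K \<subseteq> {a..b}"
  proof (cases "K = {}")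
    case True
    then show ?thesis using that[of "T/2" "T/2"] T by auto
  next
    case False
    obtain a where "a \<in> K" "\<And>x. x \<in> K \<Longrightarrow> a \<le> x" using compact_attains_inf[OF K(1) False] by auto
    moreover obtain b where "b \<in> K" "\<And>x. x \<in> K \<Longrightarrow> x \<le> b" using compact_attains_sup[OF K(1) False] by auto
    ultimately show ?thesis using K(2) by (intro that[of a b]) auto
  qed
  \<comment> \<open>Passing to the midpoints towards 0 and \<open>T\<close> makes
    \<open>\<phi>\<close> vanish at \<open>p\<close> and \<open>q\<close> themselves and gives
    \<open>p < q\<close> even if \<open>a = b\<close>.\<close>
  show ?thesis
  proof (rule that[of "a/2" "(b+T)/2"])
    fix x assume "x \<le> a/2 \<or> (b+T)/2 \<le> x"
    then have "x \<notin> {a..b}" using ab by auto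
    with ab K(3) show "\<phi> x = 0" by blast
  qed (use ab in auto)
qed

lemma test_function_deriv:
  assumes T: "0 < T" and \<phi>: "test_function T \<phi>"
  shows "test_function T (deriv \<phi>)"
proof -
  obtain p q where pq: "0 < p" "p < q" "q < T" "\<And>x. x \<le> p \<or> q \<le> x \<Longrightarrow> \<phi> x = 0"
    using test_function_support[OF T \<phi>] by metis
  have z: "deriv \<phi> x = 0" if "x \<notin> {p..q}" for x
  proof (rule DERIV_imp_deriv)
    have "((\<lambda>_. 0) has_field_derivative 0) (at x)" by simp
    then show "(\<phi> has_field_derivative 0) (at x)"
      by (rule has_field_derivative_transform_within_open[of _ _ _ "- {p..q}"])
         (use that pq in auto)
  qed
  show ?thesis unfolding test_function_iff
  proof (intro conjI allI exI[of _ "{p..q}"] impI z)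
    show "diff_upto n (deriv \<phi>)" for n
      using \<phi> unfolding test_function_iff by (metis diff_upto_Suc)
  qed (use pq in auto)
qed

text \<open>The primitive taken from 0 has compact support because the total integral is 0: to the
  right of the support of \<open>\<theta>\<close> it equals that total.\<close>

lemma test_function_primitive:
  assumes T: "0 < T" and \<theta>: "test_function T \<theta>" and int: "integral {0..T} \<theta> = 0"
  obtains \<phi> where "test_function T \<phi>" "deriv \<phi> = \<theta>"
proof -
  obtain p q where pq: "0 < p" "p < q" "q < T" "\<And>x. x \<le> p \<or> q \<le> x \<Longrightarrow> \<theta> x = 0"
    using test_function_support[OF T \<theta>] by metis
  have cont: "continuous_on S \<theta>" for S by (rule test_function_continuous[OF \<theta>])
  have intble: "\<theta> integrable_on {a..b}" for a b by (intro integrable_continuous_interval cont)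
  define \<phi> where "\<phi> t = integral {0..t} \<theta>" for t
  have zero: "integral {a..b} \<theta> = 0" if "b \<le> p \<or> q \<le> a" for a b
    using that pq(4) by (subst Henstock_Kurzweil_Integration.integral_cong[of _ _ "\<lambda>_. 0"]) auto
  \<comment> \<open>For negative \<open>t\<close> the interval \<open>{0..t}\<close> is empty and
    its integral is 0. As \<open>\<theta>\<close> vanishes to the left of \<open>p\<close>, the base
    point can be moved to any negative \<open>a\<close>, and every \<open>x\<close> becomes interior
    to an interval on which the fundamental theorem applies.\<close>
  have shift: "\<phi> t = integral {a..t} \<theta>" if "a < 0" for a t
  proof (cases "0 \<le> t")
    case True
    then show ?thesis
      using Henstock_Kurzweil_Integration.integral_combine[of a 0 t \<theta>] that intble zero[of 0 a] pq
      by (simp add: \<phi>_def)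
  next
    case False
    then show ?thesis using zero[of t a] pq by (simp add: \<phi>_def)
  qed
  have deriv: "(\<phi> has_field_derivative \<theta> x) (at x)" for x
  proof -
    let ?a = "- \<bar>x\<bar> - 1" and ?b = "\<bar>x\<bar> + 1"
    have "((\<lambda>u. integral {?a..u} \<theta>) has_real_derivative \<theta> x) (at x within {?a..?b})"
      by (rule integral_has_real_derivative[OF cont]) auto
    moreover have "at x within {?a..?b} = at x"
      by (rule at_within_interior) (auto simp: abs_if)
    moreover have "\<phi> = (\<lambda>u. integral {?a..u} \<theta>)"
      by (intro ext shift) simp
    ultimately show ?thesis by simp
  qed
  have d: "deriv \<phi> = \<theta>" using deriv by (intro ext DERIV_imp_deriv)
  have "test_function T \<phi>"
    unfolding test_function_iff
  proof (intro conjI allI exI[of _ "{p..q}"] impI)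
    show "diff_upto n \<phi>" for n
    proof (rule diff_upto_mono[of "Suc n"])
      show "diff_upto (Suc n) \<phi>"
        using \<theta> by (intro diff_upto_SucI[OF deriv]) (simp add: test_function_iff)
    qed simp
    fix x assume x: "x \<notin> {p..q}"
    show "\<phi> x = 0"
    proof (cases "x < p")
      case True
      then show ?thesis unfolding \<phi>_def by (intro zero) simp
    next
      case False
      then have "q < x" using x by auto
      have "integral {0..q} \<theta> + integral {q..x} \<theta> = integral {0..x} \<theta>"
        by (intro Henstock_Kurzweil_Integration.integral_combine intble) (use pq \<open>q < x\<close> in auto)
      moreover have "integral {0..q} \<theta> + integral {q..T} \<theta> = integral {0..T} \<theta>"
        by (intro Henstock_Kurzweil_Integration.integral_combine intble) (use pq in auto)
      ultimately show ?thesis unfolding \<phi>_def using int zero[of x q] zero[of T q] by simp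
    qed
  qed (use pq in auto)
  then show ?thesis using d that by blast
qed

lemma test_function_diff_scaled:
  assumes "test_function T \<phi>" "test_function T \<psi>"
  shows "test_function T (\<lambda>x. \<phi> x - c * \<psi> x)"
proof -
  obtain K K' where K: "compact K" "K \<subseteq> {0<..<T}" "\<And>x. x \<notin> K \<Longrightarrow> \<phi> x = 0"
    and K': "compact K'" "K' \<subseteq> {0<..<T}" "\<And>x. x \<notin> K' \<Longrightarrow> \<psi> x = 0"
    using assms unfolding test_function_iff by blast
  have "diff_upto n (\<lambda>x. \<phi> x + (- c) * \<psi> x)" for n
    using assms unfolding test_function_iff
    by (intro diff_upto_add diff_upto_mult diff_upto_const) auto
  then have "diff_upto n (\<lambda>x. \<phi> x - c * \<psi> x)" for n by simp
  then show ?thesis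
    unfolding test_function_iff
  proof (intro conjI allI exI[of _ "K \<union> K'"] impI)
    show "K \<union> K' \<subseteq> {0<..<T}" using K(2) K'(2) by (rule Un_least)
  qed (auto simp: K K' compact_Un)
qed

text \<open>Each bump vanishes outside the interval from \<open>p n\<close> to \<open>q n\<close>,
  which lies inside \<open>{a<..<b}\<close>, so off the open interval (endpoints included) all terms
  are 0; inside, both exponents tend to 0.\<close>

lemma bump_tendsto_indicator:
  assumes "p \<longlonglongrightarrow> a" "q \<longlonglongrightarrow> b" "\<And>n. a \<le> p n" "\<And>n. q n \<le> b"
  shows "(\<lambda>n. bump (1 / real (Suc n)) (p n) (q n) x) \<longlonglongrightarrow> indicator {a<..<b} x"
proof (cases "x \<in> {a<..<b}")
  case True
  have l: "(\<lambda>n. 1 / real (Suc n)) \<longlonglongrightarrow> 0" by (rule LIMSEQ_Suc[OF lim_1_over_n])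
  have "(\<lambda>n. exp (- ((1 / real (Suc n)) / (x - p n))) * exp (- ((1 / real (Suc n)) / (q n - x))))
     \<longlonglongrightarrow> exp (- (0 / (x - a))) * exp (- (0 / (b - x)))"
    using True by (intro tendsto_intros assms l) auto
  moreover have "\<forall>\<^sub>F n in sequentially. p n < x" "\<forall>\<^sub>F n in sequentially. x < q n"
    using True assms by (auto intro: order_tendstoD)
  then have "\<forall>\<^sub>F n in sequentially. exp (- ((1 / real (Suc n)) / (x - p n))) * exp (- ((1 / real (Suc n)) / (q n - x)))
     = bump (1 / real (Suc n)) (p n) (q n) x"
    by eventually_elim (simp add: bump_def)
  ultimately show ?thesis using True by (simp add: Lim_transform_eventually)
next
  case False
  then have "bump (1 / real (Suc n)) (p n) (q n) x = 0" for n
    using assms(3)[of n] assms(4)[of n] by (auto simp: bump_def)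
  then show ?thesis using False by simp
qed

section \<open>Functions with integrable distributional derivative\<close>

text \<open>The simple approximation takes place in the real argument of \<open>F\<close> and not in
  the target space, where it would ask for separability.\<close>

lemma strongly_measurable_continuous_compose:
  fixes r :: "'c \<Rightarrow> real" and F :: "real \<Rightarrow> 'a::real_normed_vector"
  assumes F: "continuous_on UNIV F" and r: "r \<in> borel_measurable M"
  shows "strongly_measurable M (\<lambda>x. F (r x))"
proof -
  obtain h where h: "\<And>i. simple_function M (h i)" "\<And>x. x \<in> space M \<Longrightarrow> (\<lambda>i. h i x) \<longlonglongrightarrow> r x"
    using borel_measurable_implies_sequence_metric[OF r] by blast
  have "AE x in M. (\<lambda>i. F (h i x)) \<longlonglongrightarrow> F (r x)"
    using h(2) by (intro AE_I2 continuous_on_tendsto_compose[OF F]) auto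
  then show ?thesis
    unfolding strongly_measurable_def
    using simple_function_compose1[OF h(1)] by (intro exI[of _ "\<lambda>i x. F (h i x)"]) auto
qed

lemma indefinite_integral_continuous:
  fixes w :: "real \<Rightarrow> real"
  assumes w: "integrable lebesgue w"
  shows "continuous_on UNIV (\<lambda>t. \<integral>x. indicator {..t} x * w x \<partial>lebesgue)"
proof (rule continuous_on_sequentiallyI)
  fix u :: "nat \<Rightarrow> real" and t assume u: "u \<longlonglongrightarrow> t"
  show "(\<lambda>n. \<integral>x. indicator {..u n} x * w x \<partial>lebesgue) \<longlonglongrightarrow> (\<integral>x. indicator {..t} x * w x \<partial>lebesgue)"
  proof (rule integral_dominated_convergence[where w="\<lambda>x. \<bar>w x\<bar>"])
    have "w \<in> borel_measurable lebesgue" using w by auto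
    then
    show "(\<lambda>x. indicator {..t} x * w x) \<in> borel_measurable lebesgue"
      "(\<lambda>x. indicator {..u n} x * w x) \<in> borel_measurable lebesgue" for n
      by (auto intro!: borel_measurable_times borel_measurable_indicator)
    show "integrable lebesgue (\<lambda>x. \<bar>w x\<bar>)" using w by auto
    show "AE x in lebesgue. norm (indicator {..u n} x * w x) \<le> \<bar>w x\<bar>" for n
      by (auto split: split_indicator)
    \<comment> \<open>At \<open>x = t\<close> the indicators can oscillate when \<open>u n\<close>
      approaches \<open>t\<close> from both sides; a single point is null.\<close>
    have "AE x in lebesgue. x \<noteq> t" by (intro AE_completion AE_lborel_singleton)
    then show "AE x in lebesgue. (\<lambda>n. indicator {..u n} x * w x) \<longlonglongrightarrow> indicator {..t} x * w x"
    proof eventually_elim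
      fix x assume "x \<noteq> t"
      have "\<forall>\<^sub>F n in sequentially. indicator {..u n} x = (indicator {..t} x :: real)"
      proof (cases "x < t")
        case True
        then have "\<forall>\<^sub>F n in sequentially. x < u n" using u by (auto intro: order_tendstoD)
        then show ?thesis by eventually_elim (use True in auto)
      next
        case False
        then have "t < x" using \<open>x \<noteq> t\<close> by simp
        then have "\<forall>\<^sub>F n in sequentially. u n < x" using u by (auto intro: order_tendstoD)
        then show ?thesis by eventually_elim (use \<open>t < x\<close> in auto)
      qed
      then have "\<forall>\<^sub>F n in sequentially. indicator {..u n} x * w x = indicator {..t} x * w x"
        by eventually_elim simp
      then show "(\<lambda>n. indicator {..u n} x * w x) \<longlonglongrightarrow> indicator {..t} x * w x"
        by (rule tendsto_eventually)
    qed
  qed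
qed

text \<open>Starting at minus infinity avoids sign conventions for negative \<open>t\<close>. In the
  application the integrand is cut off to \<open>(0, T)\<close>, so that this is the integral from
  0.\<close>

definition indef :: "(real \<Rightarrow> 'a::real_normed_vector) \<Rightarrow> real \<Rightarrow> 'a" where
  "indef v t = vec_integral lebesgue (\<lambda>x. indicator {..t} x *\<^sub>R v x)"

lemma vec_integrable_indicator:
  fixes v :: "real \<Rightarrow> 'a::banach"
  shows "vec_integrable lebesgue v \<Longrightarrow> A \<in> sets lebesgue \<Longrightarrow> vec_integrable lebesgue (\<lambda>x. indicator A x *\<^sub>R v x)"
  by (rule completion.vec_integrable_mult_bounded[of _ _ _ 1]) (auto split: split_indicator)

lemma indef_diff:
  fixes v :: "real \<Rightarrow> 'a::banach"
  assumes v: "vec_integrable lebesgue v" and st: "s \<le> t"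
  shows "indef v t - indef v s = vec_integral lebesgue (\<lambda>x. indicator {s<..t} x *\<^sub>R v x)"
proof -
  have "indef v t - indef v s = vec_integral lebesgue (\<lambda>x. indicator {..t} x *\<^sub>R v x - indicator {..s} x *\<^sub>R v x)"
    unfolding indef_def by (intro completion.vec_integral_diff[symmetric] vec_integrable_indicator v) auto
  also have "(\<lambda>x. indicator {..t} x *\<^sub>R v x - indicator {..s} x *\<^sub>R v x) = (\<lambda>x. indicator {s<..t} x *\<^sub>R v x)"
    using st by (auto split: split_indicator)
  finally show ?thesis .
qed

text \<open>The bound is an increment of one monotone scalar function. Continuity of
  \<open>indef v\<close> and the estimates in the integration by parts are thereby reduced to a real
  integral.\<close>

lemma indef_diff_bound:
  fixes v :: "real \<Rightarrow> 'a::banach"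
  assumes v: "vec_integrable lebesgue v" and st: "s \<le> t"
  shows "norm (indef v t - indef v s) \<le> (\<integral>x. indicator {..t} x * norm (v x) \<partial>lebesgue) - (\<integral>x. indicator {..s} x * norm (v x) \<partial>lebesgue)"
proof -
  have i: "integrable lebesgue (\<lambda>x. indicator A x * norm (v x))" if "A \<in> sets lebesgue" for A
    using completion.vec_integrable_norm[OF vec_integrable_indicator[OF v that]] by simp
  have "norm (indef v t - indef v s) \<le> (\<integral>x. norm (indicator {s<..t} x *\<^sub>R v x) \<partial>lebesgue)"
    unfolding indef_diff[OF assms] by (intro completion.norm_vec_integral_le vec_integrable_indicator v) auto
  also have "\<dots> = (\<integral>x. indicator {..t} x * norm (v x) - indicator {..s} x * norm (v x) \<partial>lebesgue)"
    using st by (intro Bochner_Integration.integral_cong) (auto split: split_indicator)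
  also have "\<dots> = (\<integral>x. indicator {..t} x * norm (v x) \<partial>lebesgue) - (\<integral>x. indicator {..s} x * norm (v x) \<partial>lebesgue)"
    by (intro Bochner_Integration.integral_diff i) auto
  finally show ?thesis .
qed

lemma indef_continuous:
  fixes v :: "real \<Rightarrow> 'a::banach"
  assumes v: "vec_integrable lebesgue v"
  shows "continuous_on UNIV (indef v)"
proof -
  define \<nu> where "\<nu> t = (\<integral>x. indicator {..t} x * norm (v x) \<partial>lebesgue)" for t
  have c: "continuous_on UNIV \<nu>"
    unfolding \<nu>_def by (intro indefinite_integral_continuous completion.vec_integrable_norm v)
  have le: "norm (indef v t - indef v s) \<le> \<bar>\<nu> t - \<nu> s\<bar>" for s t
    using indef_diff_bound[OF v, of s t] indef_diff_bound[OF v, of t s]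
    unfolding \<nu>_def by (cases "s \<le> t") (auto simp: norm_minus_commute)
  show ?thesis
    unfolding continuous_on_def
  proof safe
    fix t
    have "(\<nu> \<longlongrightarrow> \<nu> t) (at t)" using c by (auto simp: continuous_on_def)
    then have "((\<lambda>s. \<bar>\<nu> s - \<nu> t\<bar>) \<longlongrightarrow> 0) (at t)" by (simp add: LIM_zero_iff tendsto_rabs_zero_iff)
    then have "((\<lambda>s. indef v s - indef v t) \<longlongrightarrow> 0) (at t)"
      by (rule Lim_null_comparison[rotated]) (simp add: le)
    then show "(indef v \<longlongrightarrow> indef v t) (at t)" by (simp add: LIM_zero_iff)
  qed
qed

lemma lebesgue_integral_FTC:
  fixes \<phi> \<phi>' :: "real \<Rightarrow> real"
  assumes "s \<le> t" "\<And>x. (\<phi> has_field_derivative \<phi>' x) (at x)" "continuous_on UNIV \<phi>'"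
  shows "integrable lebesgue (\<lambda>x. indicator {s<..t} x * \<phi>' x)"
    "(\<integral>x. indicator {s<..t} x * \<phi>' x \<partial>lebesgue) = \<phi> t - \<phi> s"
proof -
  have c: "isCont \<phi>' x" for x using assms(3) by (simp add: continuous_on_eq_continuous_at)
  have b: "has_bochner_integral lborel (\<lambda>x. \<phi>' x * indicator {s..t} x) (\<phi> t - \<phi> s)"
    using assms c by (intro has_bochner_integral_FTC_Icc_real)
  then have "has_bochner_integral lebesgue (\<lambda>x. \<phi>' x * indicator {s..t} x) (\<phi> t - \<phi> s)"
    by (auto simp: has_bochner_integral_iff integrable_completion integral_completion)
  moreover have "AE x in lebesgue. \<phi>' x * indicator {s..t} x = indicator {s<..t} x * \<phi>' x"
    using AE_completion[OF AE_lborel_singleton[of s]] by eventually_elim (auto split: split_indicator)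
  moreover have [measurable]: "\<phi>' \<in> borel_measurable lebesgue"
    using borel_measurable_continuous_onI[OF assms(3)] by (simp add: measurable_completion)
  ultimately have "has_bochner_integral lebesgue (\<lambda>x. indicator {s<..t} x * \<phi>' x) (\<phi> t - \<phi> s)"
    by (subst has_bochner_integral_cong_AE[symmetric, of "\<lambda>x. \<phi>' x * indicator {s..t} x"])
       (auto intro!: borel_measurable_times borel_measurable_indicator)
  then show "integrable lebesgue (\<lambda>x. indicator {s<..t} x * \<phi>' x)"
    "(\<integral>x. indicator {s<..t} x * \<phi>' x \<partial>lebesgue) = \<phi> t - \<phi> s"
    by (auto simp: has_bochner_integral_iff)
qed

text \<open>The function \<open>H t = \<integral>\<^bsub>-\<infinity>\<^esub>\<^bsup>t\<^esup> (\<phi> v + \<phi>' F) - \<phi> t *\<^sub>R F t\<close> with \<open>F = indef v\<close> satisfies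
  \<open>norm (H t - H s) \<le> 2 L \<bar>t - s\<bar> \<integral>\<^bsub>s\<^esub>\<^bsup>t\<^esup> norm v\<close>, hence it is constant. This avoids a
  vector-valued Fubini theorem.\<close>

lemma vec_integral_by_parts:
  fixes v :: "real \<Rightarrow> 'a::banach"
  assumes v: "vec_integrable lebesgue v"
    and d: "\<And>x. (\<phi> has_field_derivative \<phi>' x) (at x)" and c: "continuous_on UNIV \<phi>'"
    and ab: "a < b" and z: "\<And>x. x \<le> a \<or> b \<le> x \<Longrightarrow> \<phi> x = 0" "\<And>x. x \<le> a \<or> b \<le> x \<Longrightarrow> \<phi>' x = 0"
  shows "vec_integrable lebesgue (\<lambda>x. \<phi> x *\<^sub>R v x)" "vec_integrable lebesgue (\<lambda>x. \<phi>' x *\<^sub>R indef v x)"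
    "vec_integral lebesgue (\<lambda>x. \<phi> x *\<^sub>R v x) = - vec_integral lebesgue (\<lambda>x. \<phi>' x *\<^sub>R indef v x)"
proof -
  have c0: "continuous_on UNIV \<phi>" by (rule DERIV_continuous_on[of _ \<phi> \<phi>']) (rule d)
  have [measurable]: "\<phi> \<in> borel_measurable lebesgue" "\<phi>' \<in> borel_measurable lebesgue"
    using borel_measurable_continuous_onI[OF c0] borel_measurable_continuous_onI[OF c] by (auto simp: measurable_completion)
  have "\<exists>B. \<forall>x\<in>{a..b}. \<bar>h x\<bar> \<le> B" if "continuous_on UNIV h" for h :: "real \<Rightarrow> real"
    using compact_imp_bounded[OF compact_continuous_image[OF continuous_on_subset[OF that subset_UNIV] compact_Icc[of a b]]]
    by (auto simp: bounded_iff)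
  from this[OF c0] this[OF c] obtain B L where B: "\<And>x. x \<in> {a..b} \<Longrightarrow> \<bar>\<phi> x\<bar> \<le> B" and L: "\<And>x. x \<in> {a..b} \<Longrightarrow> \<bar>\<phi>' x\<bar> \<le> L"
    by blast
  have B: "\<bar>\<phi> x\<bar> \<le> B" for x
    using B[of x] B[of a] z(1)[of x] ab by (cases "x \<le> a \<or> b \<le> x") auto
  have L: "\<bar>\<phi>' x\<bar> \<le> L" for x
    using L[of x] L[of a] z(2)[of x] ab by (cases "x \<le> a \<or> b \<le> x") auto
  have L0: "0 \<le> L" using L[of a] by simp
  show i1: "vec_integrable lebesgue (\<lambda>x. \<phi> x *\<^sub>R v x)"
    by (rule completion.vec_integrable_mult_bounded[OF v _ B]) measurable
  define F where "F = indef v"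
  define \<nu> where "\<nu> t = (\<integral>x. indicator {..t} x * norm (v x) \<partial>lebesgue)" for t
  have nu_c: "continuous_on UNIV \<nu>"
    unfolding \<nu>_def by (intro indefinite_integral_continuous completion.vec_integrable_norm v)
  have F_le: "norm (F t - F s) \<le> \<nu> t - \<nu> s" if "s \<le> t" for s t
    using indef_diff_bound[OF v that] by (simp add: F_def \<nu>_def)
  have nu_mono: "\<nu> s \<le> \<nu> t" if "s \<le> t" for s t
    using order_trans[OF norm_ge_zero F_le[OF that]] by simp
  have F_c: "continuous_on UNIV F" unfolding F_def by (rule indef_continuous[OF v])
  have F_m: "strongly_measurable lebesgue F"
    using strongly_measurable_continuous_compose[OF F_c, of "\<lambda>x. x" lebesgue] measurable_completion[of "\<lambda>x. x" lborel borel]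
    by simp
  have int_Ioc: "integrable lebesgue (indicat_real {s<..t})" for s t :: real
    by (cases "s \<le> t") (auto intro!: integrable_real_indicator)
  have "\<exists>C. \<forall>x\<in>{a..b}. norm (F x) \<le> C"
    using compact_imp_bounded[OF compact_continuous_image[OF continuous_on_subset[OF F_c subset_UNIV] compact_Icc[of a b]]]
    by (auto simp: bounded_iff)
  then obtain C where C: "\<And>x. x \<in> {a..b} \<Longrightarrow> norm (F x) \<le> C" by blast
  show i2: "vec_integrable lebesgue (\<lambda>x. \<phi>' x *\<^sub>R indef v x)"
    unfolding F_def[symmetric]
  proof (rule completion.vec_integrable_bound)
    show "AE x in lebesgue. norm (\<phi>' x *\<^sub>R F x) \<le> L * C * indicator {a<..b} x"
    proof (rule AE_I2)
      fix x
      show "norm (\<phi>' x *\<^sub>R F x) \<le> L * C * indicator {a<..b} x"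
        using z(2)[of x] mult_mono[OF L[of x] C[of x]] L0 by (cases "x \<in> {a<..b}") auto
    qed
    show "integrable lebesgue (\<lambda>x. L * C * indicator {a<..b} x)" using int_Ioc by simp
  qed (intro strongly_measurable_scaleR F_m, measurable)
  define G where "G x = \<phi> x *\<^sub>R v x + \<phi>' x *\<^sub>R F x" for x
  have iG: "vec_integrable lebesgue G"
    unfolding G_def using i1 i2 by (intro completion.vec_integrable_add) (auto simp: F_def)
  define H where "H t = indef G t - \<phi> t *\<^sub>R F t" for t
  \<comment> \<open>The increment of \<open>\<phi> F\<close> is expanded with
    \<open>\<phi> t\<close> frozen in front of \<open>v\<close> and \<open>F s\<close> frozen behind
    \<open>\<phi>'\<close>. The integrand of \<open>H t - H s\<close> becomes
    \<open>(\<phi> x - \<phi> t) v x + \<phi>' x (F x - F s)\<close>, and each term carries a small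
    increment: the first is bounded through \<open>L * (t - s)\<close>, the second through the
    increment of \<open>\<nu>\<close>.\<close>
  have H_le: "norm (H t - H s) \<le> 2 * L * (t - s) * (\<nu> t - \<nu> s)" if st: "s \<le> t" for s t
  proof -
    let ?I = "\<lambda>x. indicat_real {s<..t} x"
    have FTC: "integrable lebesgue (\<lambda>x. ?I x * \<phi>' x)" "(\<integral>x. ?I x * \<phi>' x \<partial>lebesgue) = \<phi> t - \<phi> s"
      by (rule lebesgue_integral_FTC[OF st d c])+
    have iv: "vec_integrable lebesgue (\<lambda>x. ?I x *\<^sub>R v x)" by (intro vec_integrable_indicator v) auto
    have "\<phi> t *\<^sub>R F t - \<phi> s *\<^sub>R F s = \<phi> t *\<^sub>R (F t - F s) + (\<phi> t - \<phi> s) *\<^sub>R F s"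
      by (simp add: algebra_simps)
    also have "\<dots> = vec_integral lebesgue (\<lambda>x. \<phi> t *\<^sub>R (?I x *\<^sub>R v x)) + vec_integral lebesgue (\<lambda>x. (?I x * \<phi>' x) *\<^sub>R F s)"
      unfolding completion.vec_integral_scaleR[OF iv] completion.vec_integral_scaleR_const[OF FTC(1)] FTC(2)
      by (simp add: F_def indef_diff[OF v st])
    also have "\<dots> = vec_integral lebesgue (\<lambda>x. \<phi> t *\<^sub>R (?I x *\<^sub>R v x) + (?I x * \<phi>' x) *\<^sub>R F s)"
      by (intro completion.vec_integral_add[symmetric] completion.vec_integrable_scaleR iv completion.vec_integrable_scaleR_const FTC)
    finally have eq1: "\<phi> t *\<^sub>R F t - \<phi> s *\<^sub>R F s = \<dots>" .
    have "H t - H s = (indef G t - indef G s) - (\<phi> t *\<^sub>R F t - \<phi> s *\<^sub>R F s)"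
      by (simp add: H_def)
    also have "\<dots> = vec_integral lebesgue (\<lambda>x. ?I x *\<^sub>R G x) - vec_integral lebesgue (\<lambda>x. \<phi> t *\<^sub>R (?I x *\<^sub>R v x) + (?I x * \<phi>' x) *\<^sub>R F s)"
      unfolding eq1 indef_diff[OF iG st] ..
    finally have "norm (H t - H s) = norm \<dots>" by simp
    also have "\<dots> \<le> (\<integral>x. norm (?I x *\<^sub>R G x - (\<phi> t *\<^sub>R (?I x *\<^sub>R v x) + (?I x * \<phi>' x) *\<^sub>R F s)) \<partial>lebesgue)"
      by (intro completion.norm_vec_integral_diff_le completion.vec_integrable_add completion.vec_integrable_scaleR iv
          completion.vec_integrable_scaleR_const FTC vec_integrable_indicator iG) auto
    also have "\<dots> \<le> (\<integral>x. L * (t - s) * (indicator {..t} x * norm (v x) - indicator {..s} x * norm (v x)) + L * (\<nu> t - \<nu> s) * ?I x \<partial>lebesgue)"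
    proof (rule integral_mono)
      show "integrable lebesgue (\<lambda>x. norm (?I x *\<^sub>R G x - (\<phi> t *\<^sub>R (?I x *\<^sub>R v x) + (?I x * \<phi>' x) *\<^sub>R F s)))"
        by (intro completion.vec_integrable_norm completion.vec_integrable_diff completion.vec_integrable_add completion.vec_integrable_scaleR iv
          completion.vec_integrable_scaleR_const FTC vec_integrable_indicator iG) auto
      show "integrable lebesgue (\<lambda>x. L * (t - s) * (indicator {..t} x * norm (v x) - indicator {..s} x * norm (v x)) + L * (\<nu> t - \<nu> s) * ?I x)"
        using completion.vec_integrable_norm[OF vec_integrable_indicator[OF v, of "{..t}"]]
          completion.vec_integrable_norm[OF vec_integrable_indicator[OF v, of "{..s}"]] int_Ioc
        by simp
      fix x
      show "norm (?I x *\<^sub>R G x - (\<phi> t *\<^sub>R (?I x *\<^sub>R v x) + (?I x * \<phi>' x) *\<^sub>R F s))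
        \<le> L * (t - s) * (indicator {..t} x * norm (v x) - indicator {..s} x * norm (v x)) + L * (\<nu> t - \<nu> s) * ?I x"
      proof (cases "x \<in> {s<..t}")
        case True
        have "\<bar>\<phi> x - \<phi> t\<bar> \<le> L * (t - s)"
        proof -
          have "norm (\<phi> x - \<phi> t) \<le> L * norm (x - t)"
            by (rule field_differentiable_bound[of UNIV \<phi> \<phi>'])
              (use d L in \<open>auto intro: has_field_derivative_at_within\<close>)
          also have "\<dots> \<le> L * (t - s)" using True L0 by (intro mult_left_mono) auto
          finally show ?thesis by simp
        qed
        moreover have "norm (F x - F s) \<le> \<nu> t - \<nu> s"
          using F_le[of s x] nu_mono[of x t] True by auto
        ultimately have "norm ((\<phi> x - \<phi> t) *\<^sub>R v x) + norm (\<phi>' x *\<^sub>R (F x - F s))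
            \<le> L * (t - s) * norm (v x) + L * (\<nu> t - \<nu> s)"
          using L[of x] L0 by (auto intro!: add_mono mult_mono)
        moreover have "G x - (\<phi> t *\<^sub>R v x + \<phi>' x *\<^sub>R F s) = (\<phi> x - \<phi> t) *\<^sub>R v x + \<phi>' x *\<^sub>R (F x - F s)"
          by (simp add: G_def algebra_simps)
        ultimately have "norm (G x - (\<phi> t *\<^sub>R v x + \<phi>' x *\<^sub>R F s)) \<le> L * (t - s) * norm (v x) + L * (\<nu> t - \<nu> s)"
          by (metis norm_triangle_le)
        then show ?thesis using True by simp
      next
        case False
        then show ?thesis using st by (auto split: split_indicator)
      qed
    qed
    also have "\<dots> = L * (t - s) * (\<nu> t - \<nu> s) + L * (\<nu> t - \<nu> s) * (t - s)"
    proof -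
      have "integrable lebesgue (\<lambda>x. indicator A x * norm (v x))" if "A \<in> sets lebesgue" for A
        using completion.vec_integrable_norm[OF vec_integrable_indicator[OF v that]] by simp
      then show ?thesis using int_Ioc st by (simp add: \<nu>_def)
    qed
    finally show ?thesis by (simp add: algebra_simps)
  qed
  have H_le': "norm (H y - H t) \<le> 2 * L * \<bar>y - t\<bar> * \<bar>\<nu> y - \<nu> t\<bar>" for y t
    using H_le[of y t] H_le[of t y] nu_mono[of y t] nu_mono[of t y]
    by (cases "y \<le> t") (auto simp: norm_minus_commute)
  \<comment> \<open>Division by the distance of \<open>y\<close> and \<open>t\<close> still leaves
    the increment of the continuous function \<open>\<nu>\<close>, so the difference quotients tend
    to 0.\<close>
  have "(H has_derivative (\<lambda>h. 0)) (at t within UNIV)" for t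
  proof (rule has_derivativeI_sandwich[of 1 _ _ _ _ "\<lambda>y. 2 * L * \<bar>\<nu> y - \<nu> t\<bar>"])
    show "norm (H y - H t - 0) / norm (y - t) \<le> 2 * L * \<bar>\<nu> y - \<nu> t\<bar>" if "y \<noteq> t" for y
      using H_le'[of y t] that by (simp add: divide_le_eq mult_ac)
    have "(\<nu> \<longlongrightarrow> \<nu> t) (at t)" using nu_c by (auto simp: continuous_on_def)
    then have "((\<lambda>s. \<bar>\<nu> s - \<nu> t\<bar>) \<longlongrightarrow> 0) (at t)" by (simp add: LIM_zero_iff tendsto_rabs_zero_iff)
    from tendsto_mult_right_zero[OF this]
    show "((\<lambda>y. 2 * L * \<bar>\<nu> y - \<nu> t\<bar>) \<longlongrightarrow> 0) (at t)" by simp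
  qed auto
  then obtain k where k: "\<And>t. H t = k"
    using has_derivative_zero_constant[of UNIV H] by auto
  \<comment> \<open>Up to \<open>a\<close> everything vanishes, and at \<open>b\<close> the boundary
    term vanishes because \<open>\<phi> b = 0\<close>; constancy of \<open>H\<close> therefore says
    that \<open>G\<close> has integral 0 over the line.\<close>
  have "H a = 0"
  proof -
    have "(\<lambda>x. indicator {..a} x *\<^sub>R G x) = (\<lambda>x. 0 *\<^sub>R G x)"
      using z by (auto simp: G_def split: split_indicator)
    then have "indef G a = 0"
      using completion.vec_integral_scaleR[OF iG, of 0] by (simp add: indef_def)
    then show ?thesis using z by (simp add: H_def)
  qed
  then have "H b = 0" using k by simp
  moreover have "(\<lambda>x. indicator {..b} x *\<^sub>R G x) = G"
    using z by (auto simp: G_def split: split_indicator)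
  ultimately have "vec_integral lebesgue G = 0" using z by (simp add: H_def indef_def)
  then show "vec_integral lebesgue (\<lambda>x. \<phi> x *\<^sub>R v x) = - vec_integral lebesgue (\<lambda>x. \<phi>' x *\<^sub>R indef v x)"
    using completion.vec_integral_add[OF i1 i2] by (simp add: G_def[abs_def] F_def eq_neg_iff_add_eq_0)
qed

section \<open>Functions orthogonal to all derivatives of test functions\<close>

lemma test_function_measurable: "test_function T \<psi> \<Longrightarrow> \<psi> \<in> borel_measurable lebesgue"
  using borel_measurable_continuous_onI[OF test_function_continuous] by (simp add: measurable_completion)

lemma test_function_bounded:
  assumes T: "0 < T" and \<psi>: "test_function T \<psi>"
  obtains B where "\<And>x. \<bar>\<psi> x\<bar> \<le> B"
proof -
  have "\<exists>B. \<forall>x\<in>{0..T}. \<bar>\<psi> x\<bar> \<le> B"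
    using compact_imp_bounded[OF compact_continuous_image[OF test_function_continuous[OF \<psi>] compact_Icc[of 0 T]]]
    by (auto simp: bounded_iff)
  then obtain B where B: "\<And>x. x \<in> {0..T} \<Longrightarrow> \<bar>\<psi> x\<bar> \<le> B" by blast
  obtain p q where pq: "0 < p" "p < q" "q < T" "\<And>x. x \<le> p \<or> q \<le> x \<Longrightarrow> \<psi> x = 0"
    using test_function_support[OF T \<psi>] by metis
  show thesis
  proof (rule that)
    show "\<bar>\<psi> x\<bar> \<le> B" for x
      using B[of x] B[of 0] pq(4)[of x] pq T by (cases "x \<le> p \<or> q \<le> x") auto
  qed
qed

text \<open>Links the gauge integral, in which primitives are built, with the Lebesgue integral, in
  which the orthogonality relations are computed.\<close>

lemma test_function_integral:
  assumes T: "0 < T" and \<psi>: "test_function T \<psi>"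
  shows "integrable lebesgue \<psi>" "integral\<^sup>L lebesgue \<psi> = integral {0..T} \<psi>"
proof -
  obtain p q where pq: "0 < p" "p < q" "q < T" "\<And>x. x \<le> p \<or> q \<le> x \<Longrightarrow> \<psi> x = 0"
    using test_function_support[OF T \<psi>] by metis
  have eq: "(\<lambda>x. indicat_real {0..T} x *\<^sub>R \<psi> x) = \<psi>"
  proof
    show "indicat_real {0..T} x *\<^sub>R \<psi> x = \<psi> x" for x
      using pq(4)[of x] pq by (cases "x \<in> {0..T}") auto
  qed
  have si: "set_integrable lborel {0..T} \<psi>"
    by (intro borel_integrable_atLeastAtMost' test_function_continuous[OF \<psi>])
  then have i: "integrable lborel \<psi>" unfolding set_integrable_def eq .
  then show "integrable lebesgue \<psi>" by (simp add: integrable_completion)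
  show "integral\<^sup>L lebesgue \<psi> = integral {0..T} \<psi>"
    using set_borel_integral_eq_integral(2)[OF si] i unfolding set_lebesgue_integral_def eq
    by (simp add: integral_completion)
qed

text \<open>Dynkin's argument: the open intervals form an intersection-stable generator of the Borel
  sets, \<open>total\<close> handles complements, and dominated convergence handles countable
  disjoint unions. A Lebesgue set differs from a Borel set by a subset of a null set.\<close>

lemma vec_integral_eq_0_on_lebesgue_sets:
  fixes k :: "real \<Rightarrow> 'a::banach"
  assumes k: "vec_integrable lebesgue k"
    and Ioo: "\<And>a b. vec_integral lebesgue (\<lambda>x. indicator {a<..<b} x *\<^sub>R k x) = 0"
    and total: "vec_integral lebesgue k = 0"
    and A: "A \<in> sets lebesgue"
  shows "vec_integral lebesgue (\<lambda>x. indicator A x *\<^sub>R k x) = 0"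
proof -
  have borel: "vec_integral lebesgue (\<lambda>x. indicator B x *\<^sub>R k x) = 0" if "B \<in> sets borel" for B
  proof -
    have "Int_stable (range (\<lambda>(a, b). box a b :: real set))"
      by (auto simp: Int_stable_def box_Int_box)
    moreover have "range (\<lambda>(a, b). box a b :: real set) \<subseteq> Pow UNIV" by auto
    moreover have "B \<in> sigma_sets UNIV (range (\<lambda>(a, b). box a b))"
      using that unfolding borel_eq_box by (simp del: box_real)
    ultimately show ?thesis
    proof (induction rule: sigma_sets_induct_disjoint)
      case (basic A)
      then show ?case using Ioo by (auto simp: box_real)
    next
      case empty
      then show ?case using Ioo[of 0 0] by simp
    next
      case (compl A)
      then have "A \<in> sets borel" unfolding borel_eq_box by (simp del: box_real)
      then have A: "A \<in> sets lebesgue" by simp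
      have "(\<lambda>x. indicator (UNIV - A) x *\<^sub>R k x) = (\<lambda>x. k x - indicator A x *\<^sub>R k x)"
        by (auto split: split_indicator)
      then show ?case
        using completion.vec_integral_diff[OF k vec_integrable_indicator[OF k A]] compl total by simp
    next
      case (union A)
      have A: "A i \<in> sets lebesgue" for i
      proof -
        have "A i \<in> sigma_sets UNIV (range (\<lambda>(a, b). box a b))" using union by auto
        then have "A i \<in> sets borel" unfolding borel_eq_box by (simp del: box_real)
        then show ?thesis by simp
      qed
      have U: "(\<Union>i<n. A i) \<in> sets lebesgue" "(\<Union>i. A i) \<in> sets lebesgue" for n :: nat
        using A by auto
      have fin: "vec_integral lebesgue (\<lambda>x. indicator (\<Union>i<n. A i) x *\<^sub>R k x) = 0" for n :: nat
      proof (induction n)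
        case 0
        then show ?case using Ioo[of 0 0] by simp
      next
        case (Suc n)
        have "A i \<inter> A n = {}" if "i < n" for i
          using union(1) that by (auto simp: disjoint_family_on_def)
        then have "(\<lambda>x. indicator (\<Union>i<Suc n. A i) x *\<^sub>R k x) = (\<lambda>x. indicator (\<Union>i<n. A i) x *\<^sub>R k x + indicator (A n) x *\<^sub>R k x)"
          by (auto simp: lessThan_Suc fun_eq_iff indicator_def)
        then show ?case
          using completion.vec_integral_add[OF vec_integrable_indicator[OF k U(1)] vec_integrable_indicator[OF k A], of n n]
            Suc union by simp
      qed
      have "(\<lambda>n. vec_integral lebesgue (\<lambda>x. indicator (\<Union>i<n. A i) x *\<^sub>R k x))
         \<longlonglongrightarrow> vec_integral lebesgue (\<lambda>x. indicator (\<Union>i. A i) x *\<^sub>R k x)"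
      proof (rule completion.vec_integral_dominated_convergence(3)[where w="\<lambda>x. norm (k x)"])
        show "AE x in lebesgue. (\<lambda>i. indicator (\<Union>i<i. A i) x *\<^sub>R k x) \<longlonglongrightarrow> indicator (\<Union>i. A i) x *\<^sub>R k x"
          by (intro AE_I2 tendsto_scaleR LIMSEQ_indicator_UN tendsto_const)
        show "AE x in lebesgue. norm (indicator (\<Union>i<n. A i) x *\<^sub>R k x) \<le> norm (k x)" for n
          by (auto split: split_indicator)
      qed (intro completion.vec_integrable_strongly_measurable vec_integrable_indicator k U completion.vec_integrable_norm)+
      then show ?case unfolding fin using LIMSEQ_unique tendsto_const by metis
    qed
  qed
  obtain S N N' where S: "A = S \<union> N" "N \<subseteq> N'" "N' \<in> null_sets lborel" "S \<in> sets lborel"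
    using A by (rule sets_completionE)
  have "AE x in lebesgue. x \<notin> N'" using S(3) by (intro AE_completion AE_not_in)
  then have "AE x in lebesgue. indicator S x *\<^sub>R k x = indicator A x *\<^sub>R k x"
    by eventually_elim (use S in \<open>auto split: split_indicator\<close>)
  then show ?thesis
    using completion.vec_integral_cong_AE(2)[OF vec_integrable_indicator[OF k, of S], of "\<lambda>x. indicator A x *\<^sub>R k x"]
      borel[of S] S(4) by simp
qed

text \<open>A test function of integral 0 is the derivative of a test function. Subtracting a
  multiple of a fixed \<open>\<rho>\<close> produces integral 0, so the pairing of \<open>g\<close>
  with \<open>\<psi>\<close> depends only on the integral of \<open>\<psi>\<close>. Hence
  \<open>g - c\<close> on \<open>(0, T)\<close> is orthogonal to all test functions and, through
  limits of bumps, has integral 0 over every interval.\<close>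

lemma du_Bois_Reymond:
  fixes g :: "real \<Rightarrow> 'a::banach"
  assumes T: "0 < T" and g: "vec_integrable lebesgue g" and g0: "\<And>x. x \<notin> {0<..<T} \<Longrightarrow> g x = 0"
    and zero: "\<And>\<phi>. test_function T \<phi> \<Longrightarrow> vec_integral lebesgue (\<lambda>x. deriv \<phi> x *\<^sub>R g x) = 0"
  obtains c where "AE x in lebesgue. x \<in> {0<..<T} \<longrightarrow> g x = c"
proof -
  have ig: "vec_integrable lebesgue (\<lambda>x. \<psi> x *\<^sub>R g x)" if "test_function T \<psi>" for \<psi>
  proof -
    obtain B where "\<And>x. \<bar>\<psi> x\<bar> \<le> B" using test_function_bounded[OF T \<open>test_function T \<psi>\<close>] by blast
    then show ?thesis
      by (intro completion.vec_integrable_mult_bounded[OF g test_function_measurable[OF that]])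
  qed
  define \<rho> where "\<rho> = bump 1 (T/3) (2*T/3)"
  have \<rho>: "test_function T \<rho>" unfolding \<rho>_def using T by (intro test_function_bump) auto
  define R where "R = integral\<^sup>L lebesgue \<rho>"
  \<comment> \<open>A nonnegative continuous function of integral 0 would vanish at
    \<open>T / 2\<close>, the centre of the support of \<open>\<rho>\<close>.\<close>
  have "R \<noteq> 0"
  proof
    assume "R = 0"
    then have "integral {0..T} \<rho> = 0"
      using test_function_integral(2)[OF T \<rho>] by (simp add: R_def)
    then have "\<rho> (T/2) = 0"
      using integral_eq_0_iff[OF test_function_continuous[OF \<rho>] T] bump_bounds[of 1] T
      by (simp add: \<rho>_def)
    then show False using T by (simp add: \<rho>_def bump_def)
  qed
  define c where "c = (1 / R) *\<^sub>R vec_integral lebesgue (\<lambda>x. \<rho> x *\<^sub>R g x)"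
  have orth: "vec_integral lebesgue (\<lambda>x. \<psi> x *\<^sub>R g x) = integral\<^sup>L lebesgue \<psi> *\<^sub>R c" if \<psi>: "test_function T \<psi>" for \<psi>
  proof -
    define C where "C = integral\<^sup>L lebesgue \<psi> / R"
    have \<theta>: "test_function T (\<lambda>x. \<psi> x - C * \<rho> x)" by (intro test_function_diff_scaled \<psi> \<rho>)
    have "integral\<^sup>L lebesgue (\<lambda>x. \<psi> x - C * \<rho> x) = integral\<^sup>L lebesgue \<psi> - C * R"
      using test_function_integral(1)[OF T \<psi>] test_function_integral(1)[OF T \<rho>] by (simp add: R_def)
    also have "\<dots> = 0" using \<open>R \<noteq> 0\<close> by (simp add: C_def)
    finally have "integral {0..T} (\<lambda>x. \<psi> x - C * \<rho> x) = 0"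
      using test_function_integral(2)[OF T \<theta>] by simp
    then obtain \<phi> where "test_function T \<phi>" "deriv \<phi> = (\<lambda>x. \<psi> x - C * \<rho> x)"
      using test_function_primitive[OF T \<theta>] by blast
    then have "0 = vec_integral lebesgue (\<lambda>x. (\<psi> x - C * \<rho> x) *\<^sub>R g x)"
      using zero by metis
    also have "(\<lambda>x. (\<psi> x - C * \<rho> x) *\<^sub>R g x) = (\<lambda>x. \<psi> x *\<^sub>R g x - C *\<^sub>R (\<rho> x *\<^sub>R g x))"
      by (simp add: scaleR_diff_left)
    also have "vec_integral lebesgue \<dots> = vec_integral lebesgue (\<lambda>x. \<psi> x *\<^sub>R g x) - C *\<^sub>R vec_integral lebesgue (\<lambda>x. \<rho> x *\<^sub>R g x)"
      using completion.vec_integral_diff[OF ig[OF \<psi>] completion.vec_integrable_scaleR[OF ig[OF \<rho>]]]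
        completion.vec_integral_scaleR[OF ig[OF \<rho>]] by simp
    finally show ?thesis by (simp add: C_def c_def)
  qed
  define k where "k x = g x - indicator {0<..<T} x *\<^sub>R c" for x
  have "integrable lebesgue (indicat_real {0<..<T})"
    using T by (intro integrable_real_indicator) auto
  note ic = completion.vec_integrable_scaleR_const[OF this, of c]
  have k: "vec_integrable lebesgue k"
    unfolding k_def using completion.vec_integrable_diff[OF g ic] .
  have \<psi>k: "vec_integral lebesgue (\<lambda>x. \<psi> x *\<^sub>R k x) = 0" if \<psi>: "test_function T \<psi>" for \<psi>
  proof -
    obtain p q where pq: "0 < p" "p < q" "q < T" "\<And>x. x \<le> p \<or> q \<le> x \<Longrightarrow> \<psi> x = 0"
      using test_function_support[OF T \<psi>] by metis
    then have "\<psi> x = 0" if "x \<notin> {0<..<T}" for x using that by auto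
    then have "(\<lambda>x. \<psi> x *\<^sub>R k x) = (\<lambda>x. \<psi> x *\<^sub>R g x - \<psi> x *\<^sub>R c)"
      by (auto simp: k_def scaleR_diff_right split: split_indicator)
    then show ?thesis
      using completion.vec_integral_diff[OF ig[OF \<psi>] completion.vec_integrable_scaleR_const[OF test_function_integral(1)[OF T \<psi>], of c]]
      by (simp add: orth[OF \<psi>] completion.vec_integral_scaleR_const[OF test_function_integral(1)[OF T \<psi>]])
  qed
  have k0: "k x = 0" if "x \<notin> {0<..<T}" for x using that g0 by (simp add: k_def)
  have Ioo: "vec_integral lebesgue (\<lambda>x. indicator {a<..<b} x *\<^sub>R k x) = 0" for a b
  proof -
    \<comment> \<open>\<open>k\<close> vanishes off \<open>(0, T)\<close>, so clipping the interval
      changes nothing. The inward shift by \<open>1 / real (Suc n)\<close> keeps the closed supports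
      of the bumps inside \<open>(0, T)\<close>; if the shifted interval is empty, the bump is
      0.\<close>
    let ?a = "max a 0" and ?b = "min b T"
    let ?\<psi> = "\<lambda>n. bump (1 / real (Suc n)) (?a + 1 / real (Suc n)) (?b - 1 / real (Suc n))"
    have l: "(\<lambda>n. 1 / real (Suc n)) \<longlonglongrightarrow> 0" by (rule LIMSEQ_Suc[OF lim_1_over_n])
    have \<psi>: "test_function T (?\<psi> n)" for n
    proof (rule test_function_bump)
      have "0 < 1 / real (Suc n)" by simp
      then show "0 < max a 0 + 1 / real (Suc n)" "min b T - 1 / real (Suc n) < T" by linarith+
    qed simp
    have "(\<lambda>n. vec_integral lebesgue (\<lambda>x. ?\<psi> n x *\<^sub>R k x)) \<longlonglongrightarrow> vec_integral lebesgue (\<lambda>x. indicator {?a<..<?b} x *\<^sub>R k x)"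
    proof (rule completion.vec_integral_dominated_convergence(3)[where w="\<lambda>x. norm (k x)"])
      have "(\<lambda>n. ?\<psi> n x) \<longlonglongrightarrow> indicator {?a<..<?b} x" for x
      proof (rule bump_tendsto_indicator)
        show "(\<lambda>n. ?a + 1 / real (Suc n)) \<longlonglongrightarrow> ?a" using tendsto_add[OF tendsto_const[of ?a] l] by simp
        show "(\<lambda>n. ?b - 1 / real (Suc n)) \<longlonglongrightarrow> ?b" using tendsto_diff[OF tendsto_const[of ?b] l] by simp
        fix n
        have "0 \<le> 1 / real (Suc n)" by simp
        then show "?a \<le> ?a + 1 / real (Suc n)" "?b - 1 / real (Suc n) \<le> ?b" by linarith+
      qed
      then show "AE x in lebesgue. (\<lambda>n. ?\<psi> n x *\<^sub>R k x) \<longlonglongrightarrow> indicator {?a<..<?b} x *\<^sub>R k x"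
        by (intro AE_I2 tendsto_scaleR tendsto_const)
      show "AE x in lebesgue. norm (?\<psi> n x *\<^sub>R k x) \<le> norm (k x)" for n
      proof (rule AE_I2)
        fix x
        have "0 \<le> ?\<psi> n x" "?\<psi> n x \<le> 1" by (rule bump_bounds, simp)+
        then show "norm (?\<psi> n x *\<^sub>R k x) \<le> norm (k x)" by (simp add: mult_left_le_one_le)
      qed
      show "strongly_measurable lebesgue (\<lambda>x. ?\<psi> n x *\<^sub>R k x)" for n
        by (intro strongly_measurable_scaleR test_function_measurable[OF \<psi>] completion.vec_integrable_strongly_measurable k)
      show "strongly_measurable lebesgue (\<lambda>x. indicator {?a<..<?b} x *\<^sub>R k x)"
        by (intro completion.vec_integrable_strongly_measurable vec_integrable_indicator k) auto
    qed (intro completion.vec_integrable_norm k)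
    then have "vec_integral lebesgue (\<lambda>x. indicator {?a<..<?b} x *\<^sub>R k x) = 0"
      unfolding \<psi>k[OF \<psi>] using LIMSEQ_unique tendsto_const by metis
    moreover have "(\<lambda>x. indicator {?a<..<?b} x *\<^sub>R k x) = (\<lambda>x. indicator {a<..<b} x *\<^sub>R k x)"
      using k0 by (auto split: split_indicator)
    ultimately show ?thesis by simp
  qed
  have "(\<lambda>x. indicator {0<..<T} x *\<^sub>R k x) = k"
    using k0 by (auto split: split_indicator)
  with Ioo[of 0 T] have "vec_integral lebesgue k = 0" by simp
  then have "AE x in lebesgue. k x = 0"
    using completion.vec_integral_sets_eq_0_imp_AE_0[OF k] vec_integral_eq_0_on_lebesgue_sets[OF k Ioo] by blast
  then have "AE x in lebesgue. x \<in> {0<..<T} \<longrightarrow> g x = c"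
    by eventually_elim (simp add: k_def)
  then show thesis by (rule that)
qed

text \<open>Integration by parts gives the indefinite integral the derivative \<open>v\<close>, so
  its difference from \<open>f\<close> has derivative 0. The bound on \<open>f\<close> makes
  \<open>f\<close> integrable up to the endpoints, as the du Bois-Reymond argument demands.\<close>

lemma has_distr_deriv_imp_indef:
  fixes f v :: "real \<Rightarrow> 'a::banach"
  assumes T: "0 < T" and f: "strongly_measurable (lebesgue_on {0<..<T}) f"
    and f_le: "AE x in lebesgue_on {0<..<T}. norm (f x) \<le> B"
    and v: "vec_integrable (lebesgue_on {0<..<T}) v" and d: "has_distr_deriv T f v"
  obtains c where "AE x in lebesgue_on {0<..<T}. f x = c + indef (\<lambda>x. indicator {0<..<T} x *\<^sub>R v x) x"
proof -
  let ?I = "indicat_real {0<..<T}"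
  define V where "V x = ?I x *\<^sub>R v x" for x
  define F where "F = indef V"
  have S: "{0<..<T} \<inter> space lebesgue \<in> sets lebesgue" by simp
  have V: "vec_integrable lebesgue V"
    using v unfolding V_def completion.vec_integrable_restrict_space[OF S] .
  have fI: "vec_integrable lebesgue (\<lambda>x. ?I x *\<^sub>R f x)"
  proof (rule completion.vec_integrable_bound)
    show "strongly_measurable lebesgue (\<lambda>x. ?I x *\<^sub>R f x)"
      using f unfolding strongly_measurable_restrict_space[OF S] .
    show "integrable lebesgue (\<lambda>x. B * ?I x)"
      using T by (intro integrable_mult_right integrable_real_indicator) auto
    show "AE x in lebesgue. norm (?I x *\<^sub>R f x) \<le> B * ?I x"
      using f_le unfolding AE_restrict_space_iff[OF S]
      by eventually_elim (auto split: split_indicator)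
  qed
  have F_c: "continuous_on UNIV F" unfolding F_def by (rule indef_continuous[OF V])
  \<comment> \<open>\<open>F\<close> stays constant to the right of \<open>T\<close>, so it has to
    be cut off like \<open>f\<close> to be integrable over the line.\<close>
  have FI: "vec_integrable lebesgue (\<lambda>x. ?I x *\<^sub>R F x)"
  proof -
    have "\<exists>C. \<forall>x\<in>{0..T}. norm (F x) \<le> C"
      using compact_imp_bounded[OF compact_continuous_image[OF continuous_on_subset[OF F_c subset_UNIV] compact_Icc[of 0 T]]]
      by (auto simp: bounded_iff)
    then obtain C where C: "\<And>x. x \<in> {0..T} \<Longrightarrow> norm (F x) \<le> C" by blast
    show ?thesis
    proof (rule completion.vec_integrable_bound)
      show "integrable lebesgue (\<lambda>x. C * ?I x)"
        using T by (intro integrable_mult_right integrable_real_indicator) auto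
      show "AE x in lebesgue. norm (?I x *\<^sub>R F x) \<le> C * ?I x"
        using C by (intro AE_I2) (auto split: split_indicator)
      show "strongly_measurable lebesgue (\<lambda>x. ?I x *\<^sub>R F x)"
        using strongly_measurable_continuous_compose[OF F_c, of "\<lambda>x. x" lebesgue]
        by (intro strongly_measurable_scaleR) (auto simp: measurable_completion)
    qed
  qed
  define g where "g x = ?I x *\<^sub>R f x - ?I x *\<^sub>R F x" for x
  have g: "vec_integrable lebesgue g"
    unfolding g_def by (intro completion.vec_integrable_diff fI FI)
  have "vec_integral lebesgue (\<lambda>x. deriv \<phi> x *\<^sub>R g x) = 0" if \<phi>: "test_function T \<phi>" for \<phi>
  proof -
    have \<phi>': "test_function T (deriv \<phi>)" by (rule test_function_deriv[OF T \<phi>])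
    obtain p q where pq: "0 < p" "p < q" "q < T" "\<And>x. x \<le> p \<or> q \<le> x \<Longrightarrow> \<phi> x = 0"
      using test_function_support[OF T \<phi>] by metis
    obtain p' q' where pq': "0 < p'" "p' < q'" "q' < T" "\<And>x. x \<le> p' \<or> q' \<le> x \<Longrightarrow> deriv \<phi> x = 0"
      using test_function_support[OF T \<phi>'] by metis
    obtain B where B: "\<And>x. \<bar>deriv \<phi> x\<bar> \<le> B" using test_function_bounded[OF T \<phi>'] by blast
    have parts: "vec_integral lebesgue (\<lambda>x. \<phi> x *\<^sub>R V x) = - vec_integral lebesgue (\<lambda>x. deriv \<phi> x *\<^sub>R F x)"
      unfolding F_def
    proof (rule vec_integral_by_parts(3)[OF V, of _ _ 0 T])
      show "(\<phi> has_real_derivative deriv \<phi> x) (at x)" for x by (rule test_function_has_derivative[OF \<phi>])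
      show "continuous_on UNIV (deriv \<phi>)" by (rule test_function_continuous[OF \<phi>'])
    qed (use pq pq' T in auto)
    have "vec_integral (lebesgue_on {0<..<T}) (\<lambda>t. deriv \<phi> t *\<^sub>R f t) =
        - vec_integral (lebesgue_on {0<..<T}) (\<lambda>t. \<phi> t *\<^sub>R v t)"
      using d \<phi> unfolding has_distr_deriv_def by blast
    then have "vec_integral lebesgue (\<lambda>x. ?I x *\<^sub>R deriv \<phi> x *\<^sub>R f x) = - vec_integral lebesgue (\<lambda>x. ?I x *\<^sub>R \<phi> x *\<^sub>R v x)"
      unfolding completion.vec_integral_restrict_space[OF S] .
    moreover have "(\<lambda>x. ?I x *\<^sub>R deriv \<phi> x *\<^sub>R f x) = (\<lambda>x. deriv \<phi> x *\<^sub>R (?I x *\<^sub>R f x))"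
      "(\<lambda>x. ?I x *\<^sub>R \<phi> x *\<^sub>R v x) = (\<lambda>x. \<phi> x *\<^sub>R V x)"
      by (auto simp: V_def)
    ultimately have 1: "vec_integral lebesgue (\<lambda>x. deriv \<phi> x *\<^sub>R (?I x *\<^sub>R f x)) = vec_integral lebesgue (\<lambda>x. deriv \<phi> x *\<^sub>R F x)"
      using parts by simp
    \<comment> \<open>The derivative of \<open>\<phi>\<close> vanishes off \<open>(0, T)\<close>, so
      the cut-off of \<open>F\<close> is invisible to it.\<close>
    have 2: "(\<lambda>x. deriv \<phi> x *\<^sub>R F x) = (\<lambda>x. deriv \<phi> x *\<^sub>R (?I x *\<^sub>R F x))"
    proof
      show "deriv \<phi> x *\<^sub>R F x = deriv \<phi> x *\<^sub>R (?I x *\<^sub>R F x)" for x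
        using pq'(4)[of x] pq' by (cases "x \<in> {0<..<T}") auto
    qed
    have 3: "(\<lambda>x. deriv \<phi> x *\<^sub>R g x) = (\<lambda>x. deriv \<phi> x *\<^sub>R (?I x *\<^sub>R f x) - deriv \<phi> x *\<^sub>R (?I x *\<^sub>R F x))"
      by (simp add: g_def scaleR_diff_right)
    show ?thesis
      unfolding 3 completion.vec_integral_diff[OF
          completion.vec_integrable_mult_bounded[OF fI test_function_measurable[OF \<phi>'] B]
          completion.vec_integrable_mult_bounded[OF FI test_function_measurable[OF \<phi>'] B]]
      using 1 unfolding 2 by simp
  qed
  moreover have "g x = 0" if "x \<notin> {0<..<T}" for x using that by (simp add: g_def)
  ultimately obtain c where "AE x in lebesgue. x \<in> {0<..<T} \<longrightarrow> g x = c"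
    using du_Bois_Reymond[OF T g] by blast
  then have "AE x in lebesgue. x \<in> {0<..<T} \<longrightarrow> f x = c + F x"
    by eventually_elim (auto simp: g_def)
  then have "AE x in lebesgue_on {0<..<T}. f x = c + F x"
    unfolding AE_restrict_space_iff[OF S] .
  then show thesis unfolding F_def V_def[abs_def] by (rule that)
qed

section \<open>Means of functions of bounded mean oscillation\<close>

lemma avg_Ioo:
  assumes "c < d"
  shows "avg {c<..<d} v = (1 / (d - c)) *\<^sub>R vec_integral lebesgue (\<lambda>x. indicator {c<..<d} x *\<^sub>R v x)"
  using assms unfolding avg_def by (simp add: completion.vec_integral_restrict_space)

text \<open>Let \<open>m\<close> be the mean over the larger interval. Averaging
  \<open>v - m\<close> over the smaller one costs at most the integral of its norm over the larger
  one divided by the smaller length, which is the ratio of lengths times a mean oscillation.\<close>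

lemma avg_diff_le_BMO_seminorm:
  fixes v :: "real \<Rightarrow> 'a::banach"
  assumes v: "vec_integrable (lebesgue_on {0<..<T}) v" and fin: "BMO_seminorm T v < \<infinity>"
    and abcd: "0 \<le> a" "a \<le> c" "c < d" "d \<le> b" "b \<le> T"
  shows "norm (avg {c<..<d} v - avg {a<..<b} v) \<le> (b - a) / (d - c) * enn2real (BMO_seminorm T v)"
proof -
  let ?B = "enn2real (BMO_seminorm T v)"
  define m where "m = avg {a<..<b} v"
  have V: "vec_integrable lebesgue (\<lambda>x. indicator {0<..<T} x *\<^sub>R v x)"
    using v by (simp add: completion.vec_integrable_restrict_space)
  have iv: "vec_integrable lebesgue (\<lambda>x. indicator {p<..<q} x *\<^sub>R v x)" if "0 \<le> p" "q \<le> T" for p q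
  proof -
    have "(\<lambda>x. indicator {p<..<q} x *\<^sub>R v x) = (\<lambda>x. indicator {p<..<q} x *\<^sub>R indicator {0<..<T} x *\<^sub>R v x)"
      using that by (auto split: split_indicator)
    then show ?thesis using vec_integrable_indicator[OF V, of "{p<..<q}"] by simp
  qed
  have ind: "integrable lebesgue (indicat_real {p<..<q})" if "p \<le> q" for p q :: real
    using that by (intro integrable_real_indicator) auto
  have im: "vec_integrable lebesgue (\<lambda>x. indicator {p<..<q} x *\<^sub>R (v x - m))" if "0 \<le> p" "q \<le> T" "p \<le> q" for p q
    using completion.vec_integrable_diff[OF iv[OF that(1,2)] completion.vec_integrable_scaleR_const[OF ind[OF that(3)], of m]]
    by (simp add: scaleR_diff_right)
  have osc: "(\<integral>x. indicator {a<..<b} x * norm (v x - m) \<partial>lebesgue) \<le> (b - a) * ?B"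
  proof -
    have "mean_osc {a<..<b} v \<le> BMO_seminorm T v"
      unfolding BMO_seminorm_def using abcd by (intro SUP_upper) (auto simp: is_interval_oo)
    then have "(\<integral>\<^sup>+x. ennreal (norm (v x - m)) \<partial>lebesgue_on {a<..<b}) / ennreal (b - a) \<le> ennreal ?B"
      using abcd fin by (simp add: mean_osc_def m_def)
    also have "(\<integral>\<^sup>+x. ennreal (norm (v x - m)) \<partial>lebesgue_on {a<..<b}) = (\<integral>\<^sup>+x. ennreal (indicator {a<..<b} x * norm (v x - m)) \<partial>lebesgue)"
      by (subst nn_integral_restrict_space) (auto intro!: nn_integral_cong split: split_indicator)
    also have "\<dots> = ennreal (\<integral>x. indicator {a<..<b} x * norm (v x - m) \<partial>lebesgue)"
      using completion.vec_integrable_norm[OF im[of a b]] abcd by (intro nn_integral_eq_integral) auto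
    finally have "(\<integral>x. indicator {a<..<b} x * norm (v x - m) \<partial>lebesgue) / (b - a) \<le> ?B"
      using abcd by (simp add: divide_ennreal integral_nonneg_AE)
    then show ?thesis using abcd by (simp add: divide_le_eq mult.commute)
  qed
  have "avg {c<..<d} v - m = (1 / (d - c)) *\<^sub>R (vec_integral lebesgue (\<lambda>x. indicator {c<..<d} x *\<^sub>R v x) - (d - c) *\<^sub>R m)"
    using abcd by (simp add: avg_Ioo scaleR_diff_right)
  also have "vec_integral lebesgue (\<lambda>x. indicator {c<..<d} x *\<^sub>R v x) - (d - c) *\<^sub>R m
     = vec_integral lebesgue (\<lambda>x. indicator {c<..<d} x *\<^sub>R (v x - m))"
    using completion.vec_integral_diff[OF iv[of c d] completion.vec_integrable_scaleR_const[OF ind[of c d], of m]]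
      completion.vec_integral_scaleR_const[OF ind[of c d], of m] abcd
    by (simp add: scaleR_diff_right)
  finally have "norm (avg {c<..<d} v - m) = norm (vec_integral lebesgue (\<lambda>x. indicator {c<..<d} x *\<^sub>R (v x - m))) / (d - c)"
    using abcd by simp
  also have "\<dots> \<le> ((b - a) * ?B) / (d - c)"
  proof (rule divide_right_mono)
    have "norm (vec_integral lebesgue (\<lambda>x. indicator {c<..<d} x *\<^sub>R (v x - m)))
       \<le> (\<integral>x. norm (indicator {c<..<d} x *\<^sub>R (v x - m)) \<partial>lebesgue)"
      using abcd by (intro completion.norm_vec_integral_le im) auto
    also have "\<dots> \<le> (\<integral>x. norm (indicator {a<..<b} x *\<^sub>R (v x - m)) \<partial>lebesgue)"
      using abcd by (intro integral_mono completion.vec_integrable_norm im) (auto split: split_indicator)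
    also have "\<dots> \<le> (b - a) * ?B" using osc by simp
    finally show "norm (vec_integral lebesgue (\<lambda>x. indicator {c<..<d} x *\<^sub>R (v x - m))) \<le> (b - a) * ?B" .
  qed (use abcd in simp)
  finally show ?thesis unfolding m_def by simp
qed

text \<open>The hypothesis \<open>T \<le> 2 ^ n * (d - c)\<close> counts the enlargements still to
  be made; for \<open>n = 0\<close> it forces the interval to be all of
  \<open>(0, T)\<close>.\<close>

lemma avg_dyadic_bound:
  fixes v :: "real \<Rightarrow> 'a::banach"
  assumes v: "vec_integrable (lebesgue_on {0<..<T}) v" and fin: "BMO_seminorm T v < \<infinity>"
    and cd: "0 \<le> c" "c < d" "d \<le> T" "T \<le> 2 ^ n * (d - c)"
  shows "norm (avg {c<..<d} v - avg {0<..<T} v) \<le> 2 * real n * enn2real (BMO_seminorm T v)"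
  using cd
proof (induction n arbitrary: c d)
  case 0
  then have "c = 0" "d = T" by auto
  then show ?case by simp
next
  case (Suc n)
  let ?B = "enn2real (BMO_seminorm T v)"
  \<comment> \<open>The length is doubled but capped at \<open>T\<close>. The new interval ends at
    \<open>d\<close> unless it would then start below 0, in which case it is shifted to start at 0;
    either way it stays inside \<open>(0, T)\<close> and contains \<open>{c<..<d}\<close>.\<close>
  define len where "len = min T (2 * (d - c))"
  define a where "a = max 0 (d - len)"
  define b where "b = a + len"
  have len: "d - c \<le> len" "len \<le> T" "len \<le> 2 * (d - c)" using Suc.prems by (auto simp: len_def)
  have ab: "0 \<le> a" "a \<le> c" "d \<le> b" "b \<le> T" "b - a = len" "a < b"
    using Suc.prems len by (auto simp: a_def b_def)
  have "T \<le> 2 ^ n * len"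
  proof (cases "T \<le> 2 * (d - c)")
    case True
    then have "len = T" by (simp add: len_def)
    then show ?thesis using Suc.prems mult_right_mono[of 1 "2 ^ n" T] by simp
  next
    case False
    then have "len = 2 * (d - c)" by (simp add: len_def)
    then have "2 ^ n * len = 2 ^ Suc n * (d - c)" by (simp only: power_Suc mult_ac)
    then show ?thesis using Suc.prems(4) by (simp only:)
  qed
  then have "norm (avg {a<..<b} v - avg {0<..<T} v) \<le> 2 * real n * ?B"
    using Suc.IH[of a b] ab by simp
  moreover have "norm (avg {c<..<d} v - avg {a<..<b} v) \<le> 2 * ?B"
  proof -
    have "norm (avg {c<..<d} v - avg {a<..<b} v) \<le> (b - a) / (d - c) * ?B"
      using ab Suc.prems by (intro avg_diff_le_BMO_seminorm v fin) auto
    also have "\<dots> \<le> 2 * ?B"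
      using len Suc.prems ab by (intro mult_right_mono) (auto simp: field_simps)
    finally show ?thesis .
  qed
  ultimately show ?case
    using norm_triangle_ineq[of "avg {c<..<d} v - avg {a<..<b} v" "avg {a<..<b} v - avg {0<..<T} v"]
    by (simp add: algebra_simps)
qed

lemma indef_BMO_bound:
  fixes v :: "real \<Rightarrow> 'a::banach"
  assumes T: "0 < T" and v: "v \<in> BMO_star T" and st: "0 \<le> s" "s < t" "t \<le> T"
  defines "V \<equiv> \<lambda>x. indicator {0<..<T} x *\<^sub>R v x"
  shows "norm (indef V t - indef V s) \<le> 3 * ((t - s) * ln (exp 1 * T / (t - s))) * BMO_star_norm T v"
proof -
  have vi: "vec_integrable (lebesgue_on {0<..<T}) v" and fin: "BMO_star_enorm T v < \<infinity>"
    using v by (auto simp: BMO_star_def)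
  then have fin': "BMO_seminorm T v < \<infinity>" by (auto simp: BMO_star_enorm_def)
  define A where "A = norm (avg {0<..<T} v)"
  define B where "B = enn2real (BMO_seminorm T v)"
  define h where "h = t - s"
  define L where "L = ln (T / h)"
  have h: "0 < h" "h \<le> T" using st by (auto simp: h_def)
  have AB: "0 \<le> A" "0 \<le> B" by (auto simp: A_def B_def)
  have N: "BMO_star_norm T v = A + B"
    using fin' by (simp add: BMO_star_norm_def BMO_star_enorm_def A_def B_def enn2real_plus)
  have L: "0 \<le> L" using h by (simp add: L_def)
  \<comment> \<open>The summand 1, contributed by \<open>exp 1\<close>, absorbs the rounding of the
    number of steps and the mean over \<open>(0, T)\<close>, also when \<open>h = T\<close> and
    \<open>L = 0\<close>.\<close>
  have lnL: "ln (exp 1 * T / h) = 1 + L"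
    using h T by (simp add: L_def ln_mult ln_div)
  have V: "vec_integrable lebesgue V"
    unfolding V_def using vi by (simp add: completion.vec_integrable_restrict_space)
  have "indef V t - indef V s = vec_integral lebesgue (\<lambda>x. indicator {s<..t} x *\<^sub>R V x)"
    using st by (intro indef_diff V) simp
  also have "\<dots> = vec_integral lebesgue (\<lambda>x. indicator {s<..<t} x *\<^sub>R v x)"
  proof (rule completion.vec_integral_cong_AE(2)[symmetric])
    show "vec_integrable lebesgue (\<lambda>x. indicator {s<..t} x *\<^sub>R V x)"
      by (intro vec_integrable_indicator V) auto
    have "AE x in lebesgue. x \<noteq> t" by (intro AE_completion AE_lborel_singleton)
    then show "AE x in lebesgue. indicator {s<..t} x *\<^sub>R V x = indicator {s<..<t} x *\<^sub>R v x"
      by eventually_elim (use st in \<open>auto simp: V_def split: split_indicator\<close>)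
  qed
  also have "\<dots> = h *\<^sub>R avg {s<..<t} v"
    using st by (simp add: avg_Ioo h_def)
  finally have "norm (indef V t - indef V s) = h * norm (avg {s<..<t} v)"
    using h by simp
  also have "\<dots> \<le> h * (3 * (1 + L) * (A + B))"
  proof (rule mult_left_mono)
    define n where "n = nat \<lceil>log 2 (T / h)\<rceil>"
    have log0: "0 \<le> log 2 (T / h)" using h by (simp add: zero_le_log_cancel_iff)
    then have n_ge: "log 2 (T / h) \<le> real n" and n_le: "real n \<le> log 2 (T / h) + 1"
      unfolding n_def by linarith+
    have "T / h = 2 powr log 2 (T / h)" using h T by simp
    also have "\<dots> \<le> 2 powr real n" using n_ge by simp
    finally have "T \<le> 2 ^ n * (t - s)" using h by (simp add: powr_realpow h_def field_simps)
    then have "norm (avg {s<..<t} v - avg {0<..<T} v) \<le> 2 * real n * B"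
      unfolding B_def using st by (intro avg_dyadic_bound vi fin')
    then have "norm (avg {s<..<t} v) \<le> A + 2 * real n * B"
      using norm_triangle_sub[of "avg {s<..<t} v" "avg {0<..<T} v"] by (simp add: A_def)
    \<comment> \<open>The rounded number of steps is at most \<open>L / ln 2 + 1\<close>. With
      \<open>ln 2 \<ge> 2/3\<close> twice this is at most \<open>3 * L + 2\<close>, which is the
      source of the 3 in \<open>C_eta\<close>.\<close>
    moreover have "2 * real n \<le> 3 * (1 + L)"
    proof -
      have "log 2 (T / h) = L / ln 2" by (simp add: log_def L_def)
      also have "\<dots> \<le> L / (2/3)" using L ln2_ge_two_thirds by (intro divide_left_mono) auto
      finally show ?thesis using n_le L by simp
    qed
    then have "2 * real n * B \<le> 3 * (1 + L) * B" using AB by (intro mult_right_mono)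
    moreover have "A \<le> 3 * (1 + L) * A" using AB L mult_right_mono[of 1 "3 * (1 + L)" A] by simp
    ultimately show "norm (avg {s<..<t} v) \<le> 3 * (1 + L) * (A + B)" by (simp add: algebra_simps)
  qed (use h in simp)
  finally show ?thesis unfolding N h_def[symmetric] lnL by (simp add: mult_ac)
qed

section \<open>The interpolation estimate\<close>

lemma K_functional_le:
  assumes "0 \<le> r" "x = i0 x0 + i1 x1"
  shows "K_functional i0 i1 r x \<le> norm x0 + r * norm x1"
  unfolding K_functional_def
proof (rule cInf_lower)
  show "bdd_below {norm x0 + r * norm x1 |x0 x1. x = i0 x0 + i1 x1}"
    using assms(1) by (intro bdd_belowI[of _ 0]) auto
qed (use assms in blast)

lemma K_functional_nonneg:
  assumes "0 \<le> r" "x \<in> couple_sum i0 i1"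
  shows "0 \<le> K_functional i0 i1 r x"
  unfolding K_functional_def
  by (rule cInf_greatest) (use assms in \<open>auto simp: couple_sum_def\<close>)

lemma range_subset_couple_sum:
  assumes "linear i1"
  shows "i0 z \<in> couple_sum i0 i1"
proof -
  have "i0 z = i0 z + i1 0" using linear_0[OF assms] by simp
  then show ?thesis unfolding couple_sum_def by blast
qed

text \<open>The assumption \<open>b(2)\<close> says that \<open>z\<close> lies in the closure in \<open>X\<^sub>0\<close> of the ball of radius
  \<open>b\<close> of \<open>X\<^sub>1\<close>; it need not lie in \<open>X\<^sub>1\<close> itself.\<close>

lemma interp_enorm_le:
  assumes i0: "linear i0" and i1: "linear i1" and j: "\<And>y. i0 (j y) = i1 y"
    and a: "norm z \<le> a"
    and b: "0 \<le> b" "\<And>\<epsilon>. 0 < \<epsilon> \<Longrightarrow> \<exists>y. norm y \<le> b \<and> norm (z - j y) \<le> \<epsilon>"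
    and \<eta>: "0 < \<eta>" "\<eta> < 1"
  shows "interp_enorm i0 i1 \<eta> (i0 z) \<le> ennreal (a powr (1 - \<eta>) * b powr \<eta>)"
  unfolding interp_enorm_def
proof (rule SUP_least)
  fix r :: real assume "r \<in> {0<..}"
  then have r: "0 < r" by simp
  define K where "K = K_functional i0 i1 r (i0 z)"
  have K0: "0 \<le> K" unfolding K_def using r by (intro K_functional_nonneg range_subset_couple_sum i1) simp
  \<comment> \<open>Here \<open>z\<close> is put entirely into X_0. The next bound splits it as
    \<open>(z - j y) + y\<close>, with the first part arbitrarily small in X_0 and the second in the
    ball of X_1.\<close>
  have Ka: "K \<le> a"
    unfolding K_def
    using K_functional_le[of r "i0 z" i0 z i1 0] linear_0[OF i1] r a by simp
  have Kb: "K \<le> r * b"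
  proof (rule field_le_epsilon)
    fix \<epsilon> :: real assume "0 < \<epsilon>"
    from b(2)[OF this] obtain y where y: "norm y \<le> b" "norm (z - j y) \<le> \<epsilon>" by blast
    have "i0 z = i0 (z - j y) + i1 y" using linear_diff[OF i0] j by simp
    then have "K \<le> norm (z - j y) + r * norm y"
      unfolding K_def using r by (intro K_functional_le) auto
    also have "\<dots> \<le> \<epsilon> + r * b" using y r by (intro add_mono mult_left_mono) auto
    finally show "K \<le> r * b + \<epsilon>" by simp
  qed
  \<comment> \<open>Bounding one factor by \<open>a\<close> and the other by \<open>r * b\<close>
    produces the geometric mean without a case split on \<open>r\<close>; the power of
    \<open>r\<close> cancels against the weight. \<open>K = 0\<close> is covered because
    \<open>0 powr x\<close> is 0.\<close>
  have "K = K powr (1 - \<eta>) * K powr \<eta>"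
    using K0 by (simp flip: powr_add)
  also have "\<dots> \<le> a powr (1 - \<eta>) * (r * b) powr \<eta>"
    using K0 Ka Kb \<eta> by (intro mult_mono powr_mono2) auto
  also have "(r * b) powr \<eta> = r powr \<eta> * b powr \<eta>"
    using r b by (simp add: powr_mult)
  finally have "r powr (- \<eta>) * K \<le> r powr (- \<eta>) * (a powr (1 - \<eta>) * (r powr \<eta> * b powr \<eta>))"
    by (intro mult_left_mono) auto
  also have "\<dots> = (r powr (- \<eta>) * r powr \<eta>) * (a powr (1 - \<eta>) * b powr \<eta>)"
    by (simp only: mult_ac)
  also have "r powr (- \<eta>) * r powr \<eta> = 1"
    using r by (simp flip: powr_add)
  finally show "ennreal (r powr - \<eta> * K_functional i0 i1 r (i0 z)) \<le> ennreal (a powr (1 - \<eta>) * b powr \<eta>)"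
    unfolding K_def by (simp add: ennreal_leI)
qed

text \<open>The logarithm is beaten by a small power:
  \<open>ln y \<le> y powr \<beta> / \<beta>\<close> at \<open>y = e T / h\<close>, which is at
  least 1. The exponent is fixed by \<open>(1 - \<beta>) * (1 - \<eta>) = \<alpha>\<close>; the
  strict inequality \<open>\<alpha> < 1 - \<eta>\<close> makes \<open>\<beta>\<close> positive, and
  \<open>D\<close> blows up as \<open>\<beta>\<close> tends to 0.\<close>

lemma log_modulus_le_powr:
  fixes T \<alpha> \<eta> :: real
  assumes T: "0 < T" and \<eta>: "\<eta> < 1" and \<alpha>: "0 < \<alpha>" "\<alpha> < 1 - \<eta>"
  obtains D where "0 \<le> D" "\<And>h. 0 < h \<Longrightarrow> h \<le> T \<Longrightarrow> (h * ln (exp 1 * T / h)) powr (1 - \<eta>) \<le> D * h powr \<alpha>"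
proof -
  define \<beta> where "\<beta> = 1 - \<alpha> / (1 - \<eta>)"
  have \<beta>: "0 < \<beta>" "(1 - \<beta>) * (1 - \<eta>) = \<alpha>" using \<alpha> \<eta> by (auto simp: \<beta>_def field_simps)
  define D where "D = ((exp 1 * T) powr \<beta> / \<beta>) powr (1 - \<eta>)"
  show thesis
  proof (rule that[of D])
    fix h :: real assume h: "0 < h" "h \<le> T"
    have ge: "1 \<le> exp 1 * T / h"
      using h T mult_mono[of 1 "exp 1" h T] by (simp add: le_divide_eq)
    have "h * ln (exp 1 * T / h) \<le> h * ((exp 1 * T / h) powr \<beta> / \<beta>)"
      using h by (intro mult_left_mono ln_powr_bound ge \<beta>) auto
    also have "\<dots> = ((exp 1 * T) powr \<beta> / \<beta>) * (h / h powr \<beta>)"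
      using h T by (simp add: powr_divide mult_ac)
    also have "h / h powr \<beta> = h powr (1 - \<beta>)" using h by (simp add: powr_diff)
    finally have "(h * ln (exp 1 * T / h)) powr (1 - \<eta>) \<le> (((exp 1 * T) powr \<beta> / \<beta>) * h powr (1 - \<beta>)) powr (1 - \<eta>)"
      using h ge \<eta> by (intro powr_mono2) auto
    also have "\<dots> = D * h powr \<alpha>"
      unfolding D_def by (subst powr_mult) (simp add: powr_powr \<beta>)
    finally show "(h * ln (exp 1 * T / h)) powr (1 - \<eta>) \<le> D * h powr \<alpha>" .
  qed (simp add: D_def)
qed

text \<open>Turns an almost everywhere property into times with that property arbitrarily close to a
  given one.\<close>

lemma AE_lebesgue_imp_ex_Ioo:
  assumes "AE x in lebesgue. P x" "p < (q::real)"
  shows "\<exists>x\<in>{p<..<q}. P x"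
proof (rule ccontr)
  assume "\<not> (\<exists>x\<in>{p<..<q}. P x)"
  with assms(1) have "AE x in lebesgue. x \<notin> {p<..<q}" by (auto elim: eventually_mono)
  then have "{p<..<q} \<in> null_sets lebesgue" by (subst (asm) AE_iff_null_sets[symmetric]) auto
  then show False using assms(2) by (simp add: null_sets_def)
qed

text \<open>\<open>j\<close> is the embedding of X_1 into X_0, and \<open>i0 (j y) = i1 y\<close>
  makes it agree with the inclusions into the ambient space. The representative \<open>w\<close> is
  quantified before \<open>\<eta>\<close>, so one function serves the whole scale of interpolation
  spaces.\<close>

theorem theorem3p12:
  fixes i0 :: "'a::banach \<Rightarrow> 'v::{real_vector, topological_ab_group_add, t2_space}"
    and i1 :: "'b::banach \<Rightarrow> 'v"
    and j :: "'b \<Rightarrow> 'a"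
    and T :: real
    and u :: "real \<Rightarrow> 'b"
    and u' :: "real \<Rightarrow> 'a"
  assumes couple: "banach_couple i0 i1"
    and embedding: "bounded_linear j" "\<And>y. i0 (j y) = i1 y"
    and T: "0 < T"
    and u: "u \<in> Linf T"
    and deriv_u: "has_distr_deriv T (\<lambda>t. j (u t)) u'"
    and u': "u' \<in> BMO_star T"
  shows "\<exists>w :: real \<Rightarrow> 'a.
    continuous_on {0..T} w \<and>
    (AE t in lebesgue_on {0<..<T}. w t = j (u t)) \<and>
    (\<forall>\<eta>. 0 < \<eta> \<and> \<eta> < 1 \<longrightarrow>
       (\<lambda>t. i0 (w t)) \<in> C_into T (interp_space i0 i1 \<eta>) (interp_enorm i0 i1 \<eta>) \<and>
       (\<forall>s\<in>{0..T}. \<forall>t\<in>{0..T}. 0 < \<bar>t - s\<bar> \<and> \<bar>t - s\<bar> \<le> T \<longrightarrow>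
          interp_enorm i0 i1 \<eta> (i0 (w t) - i0 (w s)) \<le>
          ennreal (C_eta \<eta> * (\<bar>t - s\<bar> * ln (exp 1 * T / \<bar>t - s\<bar>)) powr (1 - \<eta>) *
                   BMO_star_norm T u' powr (1 - \<eta>) * Linf_norm T u powr \<eta>)) \<and>
       (\<forall>\<alpha>. 0 < \<alpha> \<and> \<alpha> < 1 - \<eta> \<longrightarrow>
          (\<lambda>t. i0 (w t)) \<in>
            Holder_into \<alpha> T (interp_space i0 i1 \<eta>) (interp_enorm i0 i1 \<eta>)))"
proof -
  have lin: "linear i0" "linear i1" using couple by (auto simp: banach_couple_def)
  let ?M = "lebesgue_on {0<..<T}"
  have S: "{0<..<T} \<inter> space lebesgue \<in> sets lebesgue" by simp
  define U where "U = Linf_norm T u"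
  define N where "N = BMO_star_norm T u'"
  have U0: "0 \<le> U" and N0: "0 \<le> N" by (auto simp: U_def N_def Linf_norm_def BMO_star_norm_def)
  \<comment> \<open>Finiteness of the essential supremum is what makes \<open>U\<close> a bound: on
    an infinite value \<open>enn2real\<close> would return 0.\<close>
  have u_le: "AE t in ?M. norm (u t) \<le> U"
    using esssup_AE[of "\<lambda>t. ennreal (norm (u t))" ?M]
  proof eventually_elim
    case (elim t)
    moreover have "Linf_enorm T u = ennreal U"
      using u by (simp add: U_def Linf_norm_def Linf_def)
    ultimately show ?case using U0 by (simp add: Linf_enorm_def)
  qed
  obtain B where B: "\<And>y. norm (j y) \<le> norm y * B" "0 < B"
    using bounded_linear.pos_bounded[OF embedding(1)] by blast
  have ju_le: "AE t in ?M. norm (j (u t)) \<le> U * B"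
    using u_le
  proof eventually_elim
    case (elim t)
    then have "norm (u t) * B \<le> U * B" using B(2) by simp
    then show ?case using B(1)[of "u t"] by linarith
  qed
  have ju: "strongly_measurable ?M (\<lambda>t. j (u t))"
    using u by (intro strongly_measurable_bounded_linear[OF embedding(1)]) (simp add: Linf_def)
  have u'_int: "vec_integrable ?M u'" using u' by (simp add: BMO_star_def)
  define V where "V x = indicator {0<..<T} x *\<^sub>R u' x" for x
  obtain c where c: "AE t in ?M. j (u t) = c + indef V t"
    using has_distr_deriv_imp_indef[OF T ju ju_le u'_int deriv_u] unfolding V_def[abs_def] by blast
  define w where "w t = c + indef V t" for t
  have "vec_integrable lebesgue V"
    using u'_int by (simp add: V_def[abs_def] completion.vec_integrable_restrict_space)
  then have w_cont: "continuous_on UNIV w"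
    unfolding w_def by (intro continuous_intros indef_continuous)
  have w_ae: "AE t in ?M. w t = j (u t)"
    using c by eventually_elim (simp add: w_def)
  \<comment> \<open>\<open>u\<close> is controlled only almost everywhere, but the good times are
    dense and \<open>w\<close> is continuous, so \<open>y = u s\<close> works for a good
    \<open>s\<close> close to \<open>t\<close>. This reaches every \<open>t\<close>, including 0 and
    \<open>T\<close>, although \<open>w t\<close> itself may lie outside X_1.\<close>
  have w_approx: "\<exists>y. norm y \<le> U \<and> norm (w t - j y) \<le> \<epsilon>" if t: "t \<in> {0..T}" and \<epsilon>: "0 < \<epsilon>" for t \<epsilon>
  proof -
    obtain \<delta> where \<delta>: "0 < \<delta>" "\<And>s. dist s t < \<delta> \<Longrightarrow> dist (w s) (w t) < \<epsilon>"
      using w_cont \<epsilon> unfolding continuous_on_iff by fastforce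
    have "AE s in lebesgue. s \<in> {0<..<T} \<longrightarrow> w s = j (u s)" "AE s in lebesgue. s \<in> {0<..<T} \<longrightarrow> norm (u s) \<le> U"
      using w_ae u_le unfolding AE_restrict_space_iff[OF S] .
    then have "AE s in lebesgue. s \<in> {0<..<T} \<longrightarrow> w s = j (u s) \<and> norm (u s) \<le> U"
      by eventually_elim simp
    moreover have "max 0 (t - \<delta>) < min T (t + \<delta>)" using t T \<delta> by auto
    ultimately obtain s where "s \<in> {max 0 (t - \<delta>)<..<min T (t + \<delta>)}" "s \<in> {0<..<T} \<longrightarrow> w s = j (u s) \<and> norm (u s) \<le> U"
      using AE_lebesgue_imp_ex_Ioo by blast
    then have s: "\<bar>s - t\<bar> < \<delta>" "w s = j (u s)" "norm (u s) \<le> U" by auto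
    then have "norm (w t - j (u s)) \<le> \<epsilon>"
      using \<delta>(2)[of s] by (simp add: dist_norm norm_minus_commute)
    with s(3) show ?thesis by blast
  qed
  \<comment> \<open>The factor 2 comes from the difference of two points of the ball of radius
    \<open>U\<close>; it becomes \<open>2 powr \<eta>\<close> in \<open>C_eta\<close>.\<close>
  have w_diff_approx: "\<exists>y. norm y \<le> 2 * U \<and> norm (w t - w s - j y) \<le> \<epsilon>"
    if st: "s \<in> {0..T}" "t \<in> {0..T}" and \<epsilon>: "0 < \<epsilon>" for s t \<epsilon>
  proof -
    obtain y where y: "norm y \<le> U" "norm (w t - j y) \<le> \<epsilon> / 2" using w_approx[OF st(2), of "\<epsilon> / 2"] \<epsilon> by auto
    obtain z where z: "norm z \<le> U" "norm (w s - j z) \<le> \<epsilon> / 2" using w_approx[OF st(1), of "\<epsilon> / 2"] \<epsilon> by auto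
    have eq: "w t - w s - j (y - z) = (w t - j y) - (w s - j z)"
      by (simp add: linear_diff[OF bounded_linear.linear[OF embedding(1)]])
    then have "norm (w t - w s - j (y - z)) \<le> \<epsilon>"
      using norm_triangle_ineq4[of "w t - j y" "w s - j z"] y z unfolding eq by linarith
    moreover have "norm (y - z) \<le> 2 * U" using norm_triangle_ineq4[of y z] y z by simp
    ultimately show ?thesis by blast
  qed
  have w_lt: "norm (w t - w s) \<le> 3 * (\<bar>t - s\<bar> * ln (exp 1 * T / \<bar>t - s\<bar>)) * N" if "0 \<le> s" "s < t" "t \<le> T" for s t
    using indef_BMO_bound[OF T u' that] that unfolding w_def V_def[abs_def] N_def by simp
  have w_le: "norm (w t - w s) \<le> 3 * (\<bar>t - s\<bar> * ln (exp 1 * T / \<bar>t - s\<bar>)) * N"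
    if "s \<in> {0..T}" "t \<in> {0..T}" "s \<noteq> t" for s t
    using w_lt[of s t] w_lt[of t s] that
    by (cases "s < t") (auto simp: norm_minus_commute abs_minus_commute)
  have i0_diff: "i0 (w t) - i0 (w s) = i0 (w t - w s)" for s t
    by (simp add: linear_diff[OF lin(1)])
  have est: "interp_enorm i0 i1 \<eta> (i0 (w t) - i0 (w s)) \<le>
      ennreal (C_eta \<eta> * (\<bar>t - s\<bar> * ln (exp 1 * T / \<bar>t - s\<bar>)) powr (1 - \<eta>) * N powr (1 - \<eta>) * U powr \<eta>)"
    if \<eta>: "0 < \<eta>" "\<eta> < 1" and st: "s \<in> {0..T}" "t \<in> {0..T}" "s \<noteq> t" for \<eta> s t
  proof -
    have "interp_enorm i0 i1 \<eta> (i0 (w t - w s)) \<le>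
      ennreal ((3 * (\<bar>t - s\<bar> * ln (exp 1 * T / \<bar>t - s\<bar>)) * N) powr (1 - \<eta>) * (2 * U) powr \<eta>)"
      using U0 by (intro interp_enorm_le[where j=j] lin embedding w_le w_diff_approx st \<eta>) auto
    also have "(3 * (\<bar>t - s\<bar> * ln (exp 1 * T / \<bar>t - s\<bar>)) * N) powr (1 - \<eta>) * (2 * U) powr \<eta> =
       C_eta \<eta> * (\<bar>t - s\<bar> * ln (exp 1 * T / \<bar>t - s\<bar>)) powr (1 - \<eta>) * N powr (1 - \<eta>) * U powr \<eta>"
      by (simp only: powr_mult C_eta_def mult_ac)
    finally show ?thesis unfolding i0_diff .
  qed
  have holder: "\<exists>D\<ge>0. \<forall>s\<in>{0..T}. \<forall>t\<in>{0..T}. s \<noteq> t \<longrightarrow>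
      interp_enorm i0 i1 \<eta> (i0 (w t) - i0 (w s)) \<le> ennreal (D * \<bar>t - s\<bar> powr \<alpha>)"
    if \<eta>: "0 < \<eta>" "\<eta> < 1" and \<alpha>: "0 < \<alpha>" "\<alpha> < 1 - \<eta>" for \<eta> \<alpha>
  proof -
    obtain D where D: "0 \<le> D" "\<And>h. 0 < h \<Longrightarrow> h \<le> T \<Longrightarrow> (h * ln (exp 1 * T / h)) powr (1 - \<eta>) \<le> D * h powr \<alpha>"
      using log_modulus_le_powr[OF T \<eta>(2) \<alpha>] by blast
    define D' where "D' = C_eta \<eta> * D * N powr (1 - \<eta>) * U powr \<eta>"
    have "interp_enorm i0 i1 \<eta> (i0 (w t) - i0 (w s)) \<le> ennreal (D' * \<bar>t - s\<bar> powr \<alpha>)"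
      if st: "s \<in> {0..T}" "t \<in> {0..T}" "s \<noteq> t" for s t
    proof -
      note est[OF \<eta> st]
      also have "ennreal (C_eta \<eta> * (\<bar>t - s\<bar> * ln (exp 1 * T / \<bar>t - s\<bar>)) powr (1 - \<eta>) * N powr (1 - \<eta>) * U powr \<eta>)
        \<le> ennreal (C_eta \<eta> * (D * \<bar>t - s\<bar> powr \<alpha>) * N powr (1 - \<eta>) * U powr \<eta>)"
        using st by (intro ennreal_leI mult_right_mono mult_left_mono D) (auto simp: C_eta_def)
      also have "C_eta \<eta> * (D * \<bar>t - s\<bar> powr \<alpha>) * N powr (1 - \<eta>) * U powr \<eta> = D' * \<bar>t - s\<bar> powr \<alpha>"
        by (simp only: D'_def mult_ac)
      finally show ?thesis .
    qed
    moreover have "0 \<le> D'" using D(1) by (simp add: D'_def C_eta_def)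
    ultimately show ?thesis by blast
  qed
  \<comment> \<open>The interpolation bound is applied to \<open>w t\<close> itself, with the crude
    \<open>norm (w t)\<close> on the X_0 side; only finiteness matters here.\<close>
  have in_space: "i0 (w t) \<in> interp_space i0 i1 \<eta>" if t: "t \<in> {0..T}" and \<eta>: "0 < \<eta>" "\<eta> < 1" for t \<eta>
  proof -
    have "interp_enorm i0 i1 \<eta> (i0 (w t)) \<le> ennreal (norm (w t) powr (1 - \<eta>) * U powr \<eta>)"
      using U0 by (intro interp_enorm_le[where j=j] lin embedding w_approx t \<eta>) auto
    also have "\<dots> < \<infinity>" by simp
    finally show ?thesis
      unfolding interp_space_def using range_subset_couple_sum[OF lin(2)] by blast
  qed
  have C: "(\<lambda>t. i0 (w t)) \<in> C_into T (interp_space i0 i1 \<eta>) (interp_enorm i0 i1 \<eta>)" if \<eta>: "0 < \<eta>" "\<eta> < 1" for \<eta>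
    unfolding C_into_def
  proof (intro CollectI conjI ballI in_space \<eta>)
    fix t assume t: "t \<in> {0..T}"
    \<comment> \<open>Continuity is read off from a Hoelder bound; any exponent strictly between 0
      and \<open>1 - \<eta>\<close> would serve.\<close>
    define \<alpha> where "\<alpha> = (1 - \<eta>) / 2"
    have \<alpha>: "0 < \<alpha>" "\<alpha> < 1 - \<eta>" using \<eta> by (auto simp: \<alpha>_def)
    obtain D where D: "\<And>s t. s \<in> {0..T} \<Longrightarrow> t \<in> {0..T} \<Longrightarrow> s \<noteq> t \<Longrightarrow>
      interp_enorm i0 i1 \<eta> (i0 (w t) - i0 (w s)) \<le> ennreal (D * \<bar>t - s\<bar> powr \<alpha>)"
      using holder[OF \<eta> \<alpha>] by blast
    have "((\<lambda>s. D * \<bar>s - t\<bar> powr \<alpha>) \<longlongrightarrow> D * \<bar>t - t\<bar> powr \<alpha>) (at t within {0..T})"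
      using \<alpha> by (intro tendsto_intros) auto
    then have "((\<lambda>s. ennreal (D * \<bar>s - t\<bar> powr \<alpha>)) \<longlongrightarrow> 0) (at t within {0..T})"
      using \<alpha> tendsto_ennrealI by fastforce
    then show "((\<lambda>s. interp_enorm i0 i1 \<eta> (i0 (w s) - i0 (w t))) \<longlongrightarrow> 0) (at t within {0..T})"
      by (rule tendsto_sandwich[OF _ _ tendsto_const, rotated 2])
         (use D t in \<open>auto simp: eventually_at_filter intro!: always_eventually\<close>)
  qed
  have H: "(\<lambda>t. i0 (w t)) \<in> Holder_into \<alpha> T (interp_space i0 i1 \<eta>) (interp_enorm i0 i1 \<eta>)"
    if \<eta>: "0 < \<eta>" "\<eta> < 1" and \<alpha>: "0 < \<alpha>" "\<alpha> < 1 - \<eta>" for \<eta> \<alpha>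
  proof -
    obtain D where D: "0 \<le> D" "\<And>s t. s \<in> {0..T} \<Longrightarrow> t \<in> {0..T} \<Longrightarrow> s \<noteq> t \<Longrightarrow>
      interp_enorm i0 i1 \<eta> (i0 (w t) - i0 (w s)) \<le> ennreal (D * \<bar>t - s\<bar> powr \<alpha>)"
      using holder[OF \<eta> \<alpha>] by blast
    have "(SUP (s, t)\<in>{(s, t). 0 \<le> s \<and> s < t \<and> t \<le> T}.
        interp_enorm i0 i1 \<eta> (i0 (w t) - i0 (w s)) / ennreal (\<bar>t - s\<bar> powr \<alpha>)) \<le> ennreal D"
    proof (rule SUP_least, clarify)
      fix s t assume "0 \<le> s" "s < t" "t \<le> T"
      then show "interp_enorm i0 i1 \<eta> (i0 (w t) - i0 (w s)) / ennreal (\<bar>t - s\<bar> powr \<alpha>) \<le> ennreal D"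
        using D(2)[of s t] D(1)
        by (intro divide_le_posI_ennreal) (auto simp: mult.commute simp flip: ennreal_mult)
    qed
    also have "\<dots> < \<infinity>" by simp
    finally show ?thesis unfolding Holder_into_def using C[OF \<eta>] by blast
  qed
  show ?thesis
  proof (intro exI[of _ w] conjI allI impI ballI)
    show "continuous_on {0..T} w" using w_cont by (rule continuous_on_subset) simp
    show "AE t in lebesgue_on {0<..<T}. w t = j (u t)" by (rule w_ae)
  next
    fix \<eta> :: real and s t
    assume "0 < \<eta> \<and> \<eta> < 1" "s \<in> {0..T}" "t \<in> {0..T}" "0 < \<bar>t - s\<bar> \<and> \<bar>t - s\<bar> \<le> T"
    then show "interp_enorm i0 i1 \<eta> (i0 (w t) - i0 (w s)) \<le>
          ennreal (C_eta \<eta> * (\<bar>t - s\<bar> * ln (exp 1 * T / \<bar>t - s\<bar>)) powr (1 - \<eta>) *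
                   BMO_star_norm T u' powr (1 - \<eta>) * Linf_norm T u powr \<eta>)"
      using est[of \<eta> s t] unfolding N_def U_def by auto
  qed (auto intro: C H)
qed

end
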